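(* Let $N$ be a finite set, $\mathcal{X}\subseteq\mathbb{R}^N_{\ge 0}$ a nonempty bounded set such that $\operatorname{conv}(\mathcal{X})$ is an integral polytope, $w$ an objective vector, $c\in\mathbb{Z}_{>0}^N$ interdiction costs and $B\in\mathbb{Z}_{>0}$ a budget. Consider the interdiction problem $$\min_{R\subseteq N,\ c(R)\le B}\ \max\{w^Tx \mid x\in\mathcal{X},\ x(e)=0\ \forall e\in R\}.$$ There is an efficient $2$-pseudoapproximation for any such interdiction problem satisfying the following conditions: (i) $w\in\{0,1\}^N$; (ii) $\mathcal{X}$ is $w$-down-closed; (iii) there is a box-$w$-DI solvable description of $\operatorname{conv}(\mathcal{X})$.
   Context: Notation: $c(R)=\sum_{e\in R}c(e)$. An integral polytope is one all of whose vertices are integral. $w$-down-closed: for $w\in\{0,1\}^N$, a set $\mathcal{X}\subseteq\mathbb{R}^N_{\ge0}$ is $w$-down-closed if for every $x\in\mathcal{X}$ and $e\in N$ with $x(e)>0$ there is $x'\le x$ (componentwise) with $x'\in\mathcal{X}$, $x'(e)=0$ and $w^Tx'\ge w^Tx-x(e)$. Box-$w$-DI solvable: a description $\{x\in\mathbb{R}^N\mid Ax\le b,\ x\ge0\}$ of a nonempty polytope is box-$w$-DI solvable if (1) for every $u\in\mathbb{R}^N_{\ge0}$ the LP $\max\{w^Tx\mid Ax\le b,\ x\le u,\ x\ge 0\}$, if feasible, has an optimal dual solution that is integral, the dual being $\min\{b^Ty+u^Tr\mid A^Ty+r\ge w,\ y\ge0,\ r\ge0\}$; and (2) for every $u\in\mathbb{R}^N_{\ge0}$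 one can decide in polynomial time whether this LP is feasible, and if so efficiently compute its optimal value and an integral vector $r\in\mathbb{Z}^N_{\ge0}$ for which there is an integral $y$ such that $(y,r)$ is an optimal dual solution. The system $Ax\le b$ itself need not be given explicitly; the only access to the feasible set is through the oracle in (2). Let $\mathrm{OPT}$ be the optimal value of the interdiction problem. For $\sigma,\tau\ge1$, a $(\sigma,\tau)$-approximate solution is a set $R\subseteq N$ with $c(R)\le\tau B$ and $\max\{w^Tx\mid x\in\mathcal{X},\ x(e)=0\ \forall e\in R\}\le\sigma\,\mathrm{OPT}$. A $2$-pseudoapproximation is an algorithm that, for any given $\alpha>0$, returns either a $(1+\alpha,1)$-approximate solution or a $(1,1+1/\alpha)$-approximate solution. Efficient means polynomial time in the input size, which comprises the binary encodings of $B$ and $c$, and of the optimal values and integral vectors $r$ returned by the oracle (in particular of $\nu^*=\max\{w^Tx\mid Ax\le b,\ x\ge0\}$). *)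

theory Defs
  imports
    "HOL-Analysis.Analysis"
    "HOL-Analysis.Finite_Function_Topology"
    "HOL-Computational_Algebra.Polynomial"
    "HOL-Library.Log_Nat"
begin

section \<open>Interdiction problems\<close>

text \<open>
  The ground set is \<open>N = {..<n}\<close>. One algorithm has to serve all \<open>n\<close>, so \<open>n\<close> must not be part of
  a type: the space of vectors indexed by \<open>N\<close> is the subspace of the real vector space
  \<^typ>\<open>nat \<Rightarrow>\<^sub>0 real\<close> of the vectors supported on \<open>{..<n}\<close>. The library orders this type
  lexicographically, so componentwise comparison is always written out.
\<close>

type_synonym point = "nat \<Rightarrow>\<^sub>0 real"

abbreviation coord :: "point \<Rightarrow> nat \<Rightarrow> real" where
  "coord \<equiv> Poly_Mapping.lookup"

definition nonneg_orthant :: "nat \<Rightarrow> point set" where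
  "nonneg_orthant n = {x. Poly_Mapping.keys x \<subseteq> {..<n} \<and> (\<forall>e<n. 0 \<le> coord x e)}"

definition objective :: "nat \<Rightarrow> (nat \<Rightarrow> int) \<Rightarrow> point \<Rightarrow> real" where
  "objective n w x = (\<Sum>e<n. real_of_int (w e) * coord x e)"

definition integral_polytope :: "point set \<Rightarrow> bool" where
  "integral_polytope P \<longleftrightarrow>
     polytope P \<and> (\<forall>v. v extreme_point_of P \<longrightarrow> (\<forall>e. coord v e \<in> \<int>))"

definition interdiction_instance ::
  "nat \<Rightarrow> point set \<Rightarrow> (nat \<Rightarrow> int) \<Rightarrow> int \<Rightarrow> bool" where
  "interdiction_instance n X c B \<longleftrightarrow>
     X \<subseteq> nonneg_orthant n \<and> X \<noteq> {} \<and> bounded X \<and> integral_polytope (convex hull X) \<and>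
     (\<forall>e<n. 0 < c e) \<and> 0 < B"

definition w_down_closed :: "nat \<Rightarrow> (nat \<Rightarrow> int) \<Rightarrow> point set \<Rightarrow> bool" where
  "w_down_closed n w X \<longleftrightarrow>
     (\<forall>x\<in>X. \<forall>e<n. 0 < coord x e \<longrightarrow>
        (\<exists>x'\<in>X. (\<forall>f<n. coord x' f \<le> coord x f) \<and> coord x' e = 0 \<and>
                objective n w x' \<ge> objective n w x - coord x e))"

text \<open>
  The maximum is written as a supremum. For a \<open>w\<close>-down-closed instance the range is nonempty
  (repeatedly zeroing coordinates shows \<open>0 \<in> X\<close>) and the maximum is attained (at a vertex of the
  face \<open>x(R) = 0\<close> of \<open>convex hull X\<close>, which lies in \<open>X\<close>).
\<close>

definition interdicted_value :: "nat \<Rightarrow> (nat \<Rightarrow> int) \<Rightarrow> point set \<Rightarrow> nat set \<Rightarrow> real" where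
  "interdicted_value n w X R = Sup (objective n w ` {x \<in> X. \<forall>e\<in>R. coord x e = 0})"

definition OPT :: "nat \<Rightarrow> (nat \<Rightarrow> int) \<Rightarrow> point set \<Rightarrow> (nat \<Rightarrow> int) \<Rightarrow> int \<Rightarrow> real" where
  "OPT n w X c B = Min (interdicted_value n w X ` {R. R \<subseteq> {..<n} \<and> sum c R \<le> B})"

definition approximate_solution ::
  "nat \<Rightarrow> (nat \<Rightarrow> int) \<Rightarrow> point set \<Rightarrow> (nat \<Rightarrow> int) \<Rightarrow> int \<Rightarrow> real \<Rightarrow> real \<Rightarrow> nat set \<Rightarrow> bool" where
  "approximate_solution n w X c B \<sigma> \<tau> R \<longleftrightarrow>
     R \<subseteq> {..<n} \<and> real_of_int (sum c R) \<le> \<tau> * real_of_int B \<and>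
     interdicted_value n w X R \<le> \<sigma> * OPT n w X c B"


section \<open>Linear descriptions and their boxed linear programs\<close>

text \<open>Only the rows \<open>i < m\<close> and columns \<open>e < n\<close> of \<open>A\<close> are used.\<close>

definition described_set ::
  "nat \<Rightarrow> nat \<Rightarrow> (nat \<Rightarrow> nat \<Rightarrow> real) \<Rightarrow> (nat \<Rightarrow> real) \<Rightarrow> point set" where
  "described_set n m A b =
     {x \<in> nonneg_orthant n. \<forall>i<m. (\<Sum>e<n. A i e * coord x e) \<le> b i}"

definition boxed_set ::
  "nat \<Rightarrow> nat \<Rightarrow> (nat \<Rightarrow> nat \<Rightarrow> real) \<Rightarrow> (nat \<Rightarrow> real) \<Rightarrow> (nat \<Rightarrow> real) \<Rightarrow> point set" where
  "boxed_set n m A b u = {x \<in> described_set n m A b. \<forall>e<n. coord x e \<le> u e}"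

definition dual_feasible ::
  "nat \<Rightarrow> nat \<Rightarrow> (nat \<Rightarrow> nat \<Rightarrow> real) \<Rightarrow> (nat \<Rightarrow> int) \<Rightarrow>
   (nat \<Rightarrow> real) \<Rightarrow> (nat \<Rightarrow> real) \<Rightarrow> bool" where
  "dual_feasible n m A w y r \<longleftrightarrow>
     (\<forall>i<m. 0 \<le> y i) \<and> (\<forall>e<n. 0 \<le> r e) \<and>
     (\<forall>e<n. real_of_int (w e) \<le> (\<Sum>i<m. A i e * y i) + r e)"

definition dual_objective ::
  "nat \<Rightarrow> nat \<Rightarrow> (nat \<Rightarrow> real) \<Rightarrow> (nat \<Rightarrow> real) \<Rightarrow>
   (nat \<Rightarrow> real) \<Rightarrow> (nat \<Rightarrow> real) \<Rightarrow> real" where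
  "dual_objective n m b u y r = (\<Sum>i<m. b i * y i) + (\<Sum>e<n. u e * r e)"

definition dual_optimal ::
  "nat \<Rightarrow> nat \<Rightarrow> (nat \<Rightarrow> nat \<Rightarrow> real) \<Rightarrow> (nat \<Rightarrow> real) \<Rightarrow> (nat \<Rightarrow> int) \<Rightarrow> (nat \<Rightarrow> real) \<Rightarrow>
   (nat \<Rightarrow> real) \<Rightarrow> (nat \<Rightarrow> real) \<Rightarrow> bool" where
  "dual_optimal n m A b w u y r \<longleftrightarrow>
     dual_feasible n m A w y r \<and>
     (\<forall>y' r'. dual_feasible n m A w y' r' \<longrightarrow>
        dual_objective n m b u y r \<le> dual_objective n m b u y' r')"

definition box_w_DI ::
  "nat \<Rightarrow> nat \<Rightarrow> (nat \<Rightarrow> nat \<Rightarrow> real) \<Rightarrow> (nat \<Rightarrow> real) \<Rightarrow> (nat \<Rightarrow> int) \<Rightarrow> bool" where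
  "box_w_DI n m A b w \<longleftrightarrow>
     (\<forall>u. (\<forall>e<n. 0 \<le> u e) \<longrightarrow> boxed_set n m A b u \<noteq> {} \<longrightarrow>
        (\<exists>y r. dual_optimal n m A b w u y r \<and> (\<forall>i<m. y i \<in> \<int>) \<and> (\<forall>e<n. r e \<in> \<int>)))"


section \<open>Encoding lengths and polynomial-time LP solvers\<close>

definition bits :: "int \<Rightarrow> nat" where
  "bits k = floorlog 2 (nat \<bar>k\<bar>) + 1"

definition rat_bits :: "rat \<Rightarrow> nat" where
  "rat_bits q = bits (fst (quotient_of q)) + bits (snd (quotient_of q))"

text \<open>
  A solver maps an upper bound vector \<open>u\<close> to \<open>None\<close> (infeasible) or to the optimal value together
  with an integral vector \<open>r\<close>. It is a black box, accompanied by its running time on each query.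
\<close>

type_synonym solver = "rat list \<Rightarrow> (rat \<times> int list) option"
type_synonym solver_time = "rat list \<Rightarrow> nat"

definition solver_correct ::
  "nat \<Rightarrow> nat \<Rightarrow> (nat \<Rightarrow> nat \<Rightarrow> real) \<Rightarrow> (nat \<Rightarrow> real) \<Rightarrow> (nat \<Rightarrow> int) \<Rightarrow> solver \<Rightarrow> bool" where
  "solver_correct n m A b w S \<longleftrightarrow>
     (\<forall>us. length us = n \<and> (\<forall>q\<in>set us. 0 \<le> q) \<longrightarrow>
        (let u = (\<lambda>e. real_of_rat (us ! e)) in
         case S us of
           None \<Rightarrow> boxed_set n m A b u = {}
         | Some (v, r) \<Rightarrow>
             boxed_set n m A b u \<noteq> {} \<and>
             real_of_rat v = Sup (objective n w ` boxed_set n m A b u) \<and>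
             length r = n \<and>
             (\<exists>y. (\<forall>i<m. y i \<in> \<int>) \<and>
                  dual_optimal n m A b w u y (\<lambda>e. real_of_int (r ! e)))))"

fun answer_size :: "(rat \<times> int list) option \<Rightarrow> nat" where
  "answer_size None = 1"
| "answer_size (Some (v, r)) = rat_bits v + (\<Sum>k\<leftarrow>r. bits k)"

text \<open>
  \<open>L\<close> is the encoding length of whatever (possibly implicit) description the solver works on.
  The time for writing down an answer is part of the running time, so the lengths of the answers
  are polynomially bounded as well.
\<close>

definition solver_polytime :: "nat \<Rightarrow> nat poly \<Rightarrow> nat \<Rightarrow> solver \<Rightarrow> solver_time \<Rightarrow> bool" where
  "solver_polytime n q L S T \<longleftrightarrow>
     (\<forall>us. length us = n \<and> (\<forall>x\<in>set us. 0 \<le> x) \<longrightarrow>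
        answer_size (S us) \<le> T us \<and> T us \<le> poly q (L + (\<Sum>x\<leftarrow>us. rat_bits x)))"

definition box_w_DI_solvable ::
  "nat \<Rightarrow> nat \<Rightarrow> (nat \<Rightarrow> nat \<Rightarrow> real) \<Rightarrow> (nat \<Rightarrow> real) \<Rightarrow> (nat \<Rightarrow> int) \<Rightarrow>
   nat poly \<Rightarrow> nat \<Rightarrow> solver \<Rightarrow> solver_time \<Rightarrow> bool" where
  "box_w_DI_solvable n m A b w q L S T \<longleftrightarrow>
     described_set n m A b \<noteq> {} \<and> polytope (described_set n m A b) \<and>
     box_w_DI n m A b w \<and> solver_correct n m A b w S \<and> solver_polytime n q L S T"


section \<open>Algorithms with access to a solver\<close>

text \<open>
  Structured programs for a random access machine with integer arrays under the logarithmic cost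
  criterion: each operation is charged the number of bits of its operands, and each array access
  additionally the number of bits of the index. This is polynomially equivalent to (oracle) Turing
  machine time. Programs are finite syntactic objects that do not depend on the input.

  A solver call reads the query \<open>u(e) = QueryNum[e] / QueryDen[e]\<close> and writes the answer to the
  \<open>Ans\<close> arrays; a rational number in \<open>AnsValue\<close> and \<open>InAlpha\<close> is stored as the numerator at index
  \<open>0\<close> and the denominator at index \<open>1\<close>.
\<close>

datatype arr =
    InSize | InObjective | InCost | InBudget | InAlpha
  | QueryNum | QueryDen
  | AnsFeasible | AnsValue | AnsDual
  | Out | Work nat

type_synonym mem = "arr \<Rightarrow> int \<Rightarrow> int"

datatype exp =
    Const int
  | Cell arr exp
  | Plus exp exp
  | Minus exp exp
  | Times exp exp
  | Div exp exp

fun eval :: "exp \<Rightarrow> mem \<Rightarrow> int" where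
  "eval (Const k) s = k"
| "eval (Cell a i) s = s a (eval i s)"
| "eval (Plus e f) s = eval e s + eval f s"
| "eval (Minus e f) s = eval e s - eval f s"
| "eval (Times e f) s = eval e s * eval f s"
| "eval (Div e f) s = eval e s div eval f s"

fun cost :: "exp \<Rightarrow> mem \<Rightarrow> nat" where
  "cost (Const k) s = bits k"
| "cost (Cell a i) s = cost i s + bits (eval i s) + bits (s a (eval i s))"
| "cost (Plus e f) s = cost e s + cost f s + bits (eval e s) + bits (eval f s)"
| "cost (Minus e f) s = cost e s + cost f s + bits (eval e s) + bits (eval f s)"
| "cost (Times e f) s = cost e s + cost f s + bits (eval e s) + bits (eval f s)"
| "cost (Div e f) s = cost e s + cost f s + bits (eval e s) + bits (eval f s)"

datatype com =
    Skip
  | Assign arr exp exp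
  | Seq com com
  | IfPos exp com com
  | WhilePos exp com
  | CallSolver

definition query :: "nat \<Rightarrow> mem \<Rightarrow> rat list" where
  "query n s = map (\<lambda>e. Fract (s QueryNum (int e)) (s QueryDen (int e))) [0..<n]"

definition query_size :: "nat \<Rightarrow> mem \<Rightarrow> nat" where
  "query_size n s = (\<Sum>e<n. bits (s QueryNum (int e)) + bits (s QueryDen (int e)))"

definition int_array :: "int list \<Rightarrow> int \<Rightarrow> int" where
  "int_array xs i = (if 0 \<le> i \<and> i < int (length xs) then xs ! nat i else 0)"

definition rat_array :: "rat \<Rightarrow> int \<Rightarrow> int" where
  "rat_array q = int_array [fst (quotient_of q), snd (quotient_of q)]"

fun store_answer :: "(rat \<times> int list) option \<Rightarrow> mem \<Rightarrow> mem" where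
  "store_answer None s = s(AnsFeasible := int_array [0])"
| "store_answer (Some (v, r)) s =
     s(AnsFeasible := int_array [1], AnsValue := rat_array v, AnsDual := int_array r)"

text \<open>
  \<open>exec n S T P s t s'\<close>: started in memory \<open>s\<close>, the program \<open>P\<close> halts after time \<open>t\<close> in memory
  \<open>s'\<close>. A solver call costs the length of the query as written plus the running time of the solver.
\<close>

inductive exec :: "nat \<Rightarrow> solver \<Rightarrow> solver_time \<Rightarrow> com \<Rightarrow> mem \<Rightarrow> nat \<Rightarrow> mem \<Rightarrow> bool"
  for n :: nat and S :: solver and T :: solver_time where
  Skip: "exec n S T Skip s 1 s"
| Assign: "exec n S T (Assign a i e) s
     (cost i s + cost e s + bits (eval i s) + bits (eval e s))
     (s(a := (s a)(eval i s := eval e s)))"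
| Seq: "exec n S T P s t s' \<Longrightarrow> exec n S T Q s' t' s'' \<Longrightarrow> exec n S T (Seq P Q) s (t + t') s''"
| IfTrue: "0 < eval g s \<Longrightarrow> exec n S T P s t s' \<Longrightarrow>
     exec n S T (IfPos g P Q) s (cost g s + bits (eval g s) + t) s'"
| IfFalse: "\<not> 0 < eval g s \<Longrightarrow> exec n S T Q s t s' \<Longrightarrow>
     exec n S T (IfPos g P Q) s (cost g s + bits (eval g s) + t) s'"
| WhileFalse: "\<not> 0 < eval g s \<Longrightarrow>
     exec n S T (WhilePos g P) s (cost g s + bits (eval g s)) s"
| WhileTrue: "0 < eval g s \<Longrightarrow> exec n S T P s t s' \<Longrightarrow> exec n S T (WhilePos g P) s' t' s'' \<Longrightarrow>
     exec n S T (WhilePos g P) s (cost g s + bits (eval g s) + t + t') s''"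
| CallSolver: "exec n S T CallSolver s
     (1 + query_size n s + T (query n s)) (store_answer (S (query n s)) s)"

lemma exec_deterministic:
  "exec n S T P s t s' \<Longrightarrow> exec n S T P s u s'' \<Longrightarrow> u = t \<and> s'' = s'"
proof (induction arbitrary: u s'' rule: exec.induct)
  case (Seq P s t s' Q t' s2)
  from Seq.prems show ?case by (cases rule: exec.cases) (use Seq.IH in blast)+
next
  case (IfTrue g s P t s' Q)
  from IfTrue.prems show ?case by (cases rule: exec.cases) (use IfTrue in blast)+
next
  case (IfFalse g s Q t s' P)
  from IfFalse.prems show ?case by (cases rule: exec.cases) (use IfFalse in blast)+
next
  case (WhileTrue g s P t s' t' s2)
  from WhileTrue.prems show ?case by (cases rule: exec.cases) (use WhileTrue in blast)+
next
  case (WhileFalse g s P)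
  from WhileFalse.prems show ?case by (cases rule: exec.cases) (use WhileFalse in blast)+
qed (auto elim: exec.cases)

definition initial_memory ::
  "nat \<Rightarrow> (nat \<Rightarrow> int) \<Rightarrow> (nat \<Rightarrow> int) \<Rightarrow> int \<Rightarrow> rat \<Rightarrow> mem" where
  "initial_memory n w c B \<alpha> = (\<lambda>a.
     case a of
       InSize \<Rightarrow> int_array [int n]
     | InObjective \<Rightarrow> int_array (map w [0..<n])
     | InCost \<Rightarrow> int_array (map c [0..<n])
     | InBudget \<Rightarrow> int_array [B]
     | InAlpha \<Rightarrow> rat_array \<alpha>
     | _ \<Rightarrow> (\<lambda>_. 0))"

definition output_set :: "nat \<Rightarrow> mem \<Rightarrow> nat set" where
  "output_set n s = {e. e < n \<and> 0 < s Out (int e)}"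

text \<open>
  The number \<open>\<nu> = max {w\<^sup>T x | A x \<le> b, x \<ge> 0}\<close> is an integer for an integral polytope and
  integral \<open>w\<close>; the rounding only serves to obtain a value of type \<^typ>\<open>int\<close>.
\<close>

definition input_size ::
  "nat \<Rightarrow> (nat \<Rightarrow> int) \<Rightarrow> (nat \<Rightarrow> int) \<Rightarrow> int \<Rightarrow> rat \<Rightarrow> real \<Rightarrow> nat \<Rightarrow> nat" where
  "input_size n w c B \<alpha> \<nu> L =
     bits (int n) + (\<Sum>e<n. bits (w e)) + (\<Sum>e<n. bits (c e)) + bits B + rat_bits \<alpha> +
     bits \<lceil>\<nu>\<rceil> + L"

end

theory Submission
  imports Defs
begin

text \<open>
  For \<open>w\<close>-down-closed \<open>X\<close> the interdicted value of \<open>R\<close> is the maximum of \<open>(w - \<chi>\<^sub>R)\<^sup>T x\<close> over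
  \<open>convex hull X\<close>. Relaxing the budget with a multiplier \<open>l \<ge> 0\<close> and dualizing gives the dual of the
  boxed linear program with upper bounds \<open>u = l c\<close>; hence the support \<open>R(l)\<close> of an integral optimal
  \<open>r\<close> minimizes (interdicted value) \<open>+ l c(R)\<close>. With multipliers \<open>k / D\<close>, \<open>D = c(N) B + 1\<close>, doubling and
  bisection find consecutive \<open>k\<close> with \<open>c(R\<^sub>1) > B \<ge> c(R\<^sub>2)\<close>, unless \<open>k = 0\<close>. All interdicted values are
  integers, so \<open>D\<close> is fine enough to give
  \<open>(B - c(R\<^sub>2)) \<nu>(R\<^sub>1) + (c(R\<^sub>1) - B) \<nu>(R\<^sub>2) \<le> OPT (c(R\<^sub>1) - c(R\<^sub>2))\<close>. Then \<open>R\<^sub>1\<close> is a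
  \<open>(1, 1 + 1/\<alpha>)\<close>-approximate solution if \<open>c(R\<^sub>1) \<le> (1 + 1/\<alpha>) B\<close>, and otherwise the inequality shows
  that \<open>R\<^sub>2\<close> is a \<open>(1 + \<alpha>, 1)\<close>-approximate one. Every number that occurs apart from the solver's
  answers is at most \<open>2\<^sup>5\<^sup>I\<close> for input size \<open>I\<close>, and there are at most \<open>6 I + O(1)\<close> solver calls.
\<close>

section \<open>Linear programming duality\<close>

text \<open>A pair \<open>(a, \<beta>)\<close> stands for the inequality
  \<open>a x \<le> \<beta>\<close>; the set collects its consequences under addition and nonnegative
  scaling. As an inductive closure it composes over several elimination rounds by transitivity;
  explicit multipliers are extracted only once, by induction, in
  \<open>approximate_strong_duality\<close>.\<close>

inductive_set nonneg_combinations ::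
  "((nat \<Rightarrow> real) \<times> real) set \<Rightarrow> ((nat \<Rightarrow> real) \<times> real) set"
  for F :: "((nat \<Rightarrow> real) \<times> real) set" where
  base: "(a, \<beta>) \<in> F \<Longrightarrow> (a, \<beta>) \<in> nonneg_combinations F"
| add: "(a, \<beta>) \<in> nonneg_combinations F \<Longrightarrow> (a', \<beta>') \<in> nonneg_combinations F \<Longrightarrow>
    (\<lambda>e. a e + a' e, \<beta> + \<beta>') \<in> nonneg_combinations F"
| scale: "(a, \<beta>) \<in> nonneg_combinations F \<Longrightarrow> 0 \<le> (t::real) \<Longrightarrow>
    (\<lambda>e. t * a e, t * \<beta>) \<in> nonneg_combinations F"

lemma nonneg_combinations_trans:
  assumes "(a, \<beta>) \<in> nonneg_combinations F'" "F' \<subseteq> nonneg_combinations F"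
  shows "(a, \<beta>) \<in> nonneg_combinations F"
  using assms by (induction) (auto intro: nonneg_combinations.intros)

text \<open>Supplies the value of an eliminated variable from its lower bounds \<open>L\<close> and
  upper bounds \<open>U\<close>, either of which may be empty.\<close>

lemma exists_between_finite_sets:
  fixes L U :: "real set"
  assumes "finite L" "finite U" "\<And>l u. l \<in> L \<Longrightarrow> u \<in> U \<Longrightarrow> l \<le> u"
  shows "\<exists>t. (\<forall>l\<in>L. l \<le> t) \<and> (\<forall>u\<in>U. t \<le> u)"
proof (cases "L = {}")
  case True
  then show ?thesis
    using assms(2) by (cases "U = {}") (auto intro: exI[of _ "Min U"])
next
  case False
  then show ?thesis
    using assms by (intro exI[of _ "Max L"]) auto
qed

text \<open>By Fourier-Motzkin elimination of the last variable.\<close>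

lemma farkas:
  assumes "finite F"
    and "\<And>x :: nat \<Rightarrow> real. \<not> (\<forall>(a, \<beta>)\<in>F. (\<Sum>e<n. a e * x e) \<le> \<beta>)"
  shows "\<exists>a \<beta>. (a, \<beta>) \<in> nonneg_combinations F \<and> (\<forall>e<n. a e = 0) \<and> \<beta> < 0"
  using assms
proof (induction n arbitrary: F)
  case 0
  then show ?case
    by (fastforce intro: nonneg_combinations.base)
next
  case (Suc n)
  \<comment> \<open>\<open>P\<close> bounds the last variable from above, \<open>Q\<close> from
    below, and \<open>Z\<close> does not involve it. In \<open>comb\<close> the multipliers
    \<open>p n\<close> and \<open>- q n\<close> are positive and make the last coefficient
    cancel.\<close>
  define P where "P = {(a, \<beta>)\<in>F. a n > 0}"
  define Q where "Q = {(a, \<beta>)\<in>F. a n < 0}"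
  define Z where "Z = {(a, \<beta>)\<in>F. a n = 0}"
  define comb :: "((nat \<Rightarrow> real) \<times> real) \<times> ((nat \<Rightarrow> real) \<times> real) \<Rightarrow> (nat \<Rightarrow> real) \<times> real" where
    "comb = (\<lambda>((p, \<beta>), (q, \<gamma>)). (\<lambda>e. p n * q e + (- q n) * p e, p n * \<gamma> + (- q n) * \<beta>))"
  define F' where "F' = Z \<union> comb ` (P \<times> Q)"
  have fin: "finite P" "finite Q" "finite Z"
    unfolding P_def Q_def Z_def by (rule finite_subset[OF _ Suc.prems(1)]; auto)+
  have F'sub: "F' \<subseteq> nonneg_combinations F"
  proof
    fix z assume "z \<in> F'"
    then consider "z \<in> Z" | p \<beta> q \<gamma> where "(p, \<beta>) \<in> P" "(q, \<gamma>) \<in> Q" "z = comb ((p, \<beta>), (q, \<gamma>))"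
      unfolding F'_def by auto
    then show "z \<in> nonneg_combinations F"
    proof cases
      case 1
      then show ?thesis by (cases z) (auto simp: Z_def intro: nonneg_combinations.base)
    next
      case 2
      then have "(p, \<beta>) \<in> nonneg_combinations F" "(q, \<gamma>) \<in> nonneg_combinations F" "p n > 0" "- q n > 0"
        by (auto simp: P_def Q_def intro: nonneg_combinations.base)
      then show ?thesis
        unfolding 2 comb_def prod.case
        by (intro nonneg_combinations.add nonneg_combinations.scale) auto
    qed
  qed
  \<comment> \<open>The cone operations preserve the vanishing of the last coefficient, which
    extends the certificate of the induction hypothesis from \<open>n\<close> to
    \<open>Suc n\<close> variables.\<close>
  have zero: "a n = 0" if "(a, \<beta>) \<in> nonneg_combinations F'" for a \<beta>
    using that by induction (auto simp: F'_def Z_def comb_def)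
  have infeasible: "\<not> (\<forall>(a, \<beta>)\<in>F'. (\<Sum>e<n. a e * x e) \<le> \<beta>)" for x :: "nat \<Rightarrow> real"
  proof
    assume x: "\<forall>(a, \<beta>)\<in>F'. (\<Sum>e<n. a e * x e) \<le> \<beta>"
    define val where "val = (\<lambda>a :: nat \<Rightarrow> real. \<Sum>e<n. a e * x e)"
    \<comment> \<open>The bound on the last variable once the other coordinates are fixed at
      \<open>x\<close>: an upper one for \<open>P\<close>, and a lower one for \<open>Q\<close>,
      where the division is by a negative number.\<close>
    define bound where "bound = (\<lambda>(a, \<beta>). (\<beta> - val a) / a n)"
    have "\<exists>t. (\<forall>l\<in>bound ` Q. l \<le> t) \<and> (\<forall>u\<in>bound ` P. t \<le> u)"
    proof (rule exists_between_finite_sets)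
      fix l u assume "l \<in> bound ` Q" "u \<in> bound ` P"
      then obtain p \<beta> q \<gamma> where pq: "(p, \<beta>) \<in> P" "(q, \<gamma>) \<in> Q"
        "u = (\<beta> - val p) / p n" "l = (\<gamma> - val q) / q n"
        by (auto simp: bound_def)
      have "comb ((p, \<beta>), (q, \<gamma>)) \<in> F'"
        using pq by (auto simp: F'_def)
      with x have "(\<Sum>e<n. (p n * q e + (- q n) * p e) * x e) \<le> p n * \<gamma> + (- q n) * \<beta>"
        unfolding comb_def by fastforce
      also have "(\<Sum>e<n. (p n * q e + (- q n) * p e) * x e) = p n * val q - q n * val p"
        by (simp add: val_def sum_distrib_left algebra_simps flip: sum_subtractf)
      finally have "p n * val q - q n * val p \<le> p n * \<gamma> - q n * \<beta>" by simp
      moreover have "p n > 0" "q n < 0"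
        using pq by (auto simp: P_def Q_def)
      ultimately show "l \<le> u"
        unfolding pq by (simp add: divide_simps algebra_simps)
    qed (use fin in auto)
    then obtain t where t: "\<And>l. l \<in> Q \<Longrightarrow> bound l \<le> t" "\<And>u. u \<in> P \<Longrightarrow> t \<le> bound u"
      by auto
    have "(\<Sum>e<Suc n. a e * (x(n := t)) e) \<le> \<beta>" if F: "(a, \<beta>) \<in> F" for a \<beta>
    proof -
      have eq: "(\<Sum>e<Suc n. a e * (x(n := t)) e) = val a + a n * t"
        by (simp add: val_def)
      consider "a n = 0" | "a n > 0" | "a n < 0" by linarith
      then show ?thesis
      proof cases
        case 1
        then have "(a, \<beta>) \<in> F'" using F by (auto simp: F'_def Z_def)
        with x 1 show ?thesis unfolding eq by (auto simp: val_def)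
      next
        case 2
        then have "t \<le> (\<beta> - val a) / a n"
          using t(2)[of "(a, \<beta>)"] F by (auto simp: P_def bound_def)
        with 2 show ?thesis unfolding eq by (simp add: field_simps)
      next
        case 3
        then have "(\<beta> - val a) / a n \<le> t"
          using t(1)[of "(a, \<beta>)"] F by (auto simp: Q_def bound_def)
        with 3 show ?thesis unfolding eq by (simp add: field_simps)
      qed
    qed
    with Suc.prems(2)[of "x(n := t)"] show False by blast
  qed
  have "finite F'" using fin by (auto simp: F'_def)
  from Suc.IH[OF this infeasible] obtain a \<beta> where
    a: "(a, \<beta>) \<in> nonneg_combinations F'" "\<forall>e<n. a e = 0" "\<beta> < 0" by blast
  then have "\<forall>e<Suc n. a e = 0" using zero less_Suc_eq by auto
  with a nonneg_combinations_trans[OF a(1) F'sub] show ?case by blast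
qed

lemma exists_point:
  "\<exists>x. Poly_Mapping.keys x \<subseteq> {..<n} \<and> (\<forall>e<n. coord x e = f e)"
proof -
  have "finite {e. (if e < n then f e else 0) \<noteq> 0}"
    by (rule finite_subset[of _ "{..<n}"]) auto
  then show ?thesis
    by (intro exI[of _ "Abs_poly_mapping (\<lambda>e. if e < n then f e else 0)"])
       (auto simp: lookup_Abs_poly_mapping keys.rep_eq split: if_splits)
qed

text \<open>
  The slack \<open>\<epsilon>\<close> avoids showing that the minimum of the dual is attained; an optimal dual solution is
  part of the assumptions wherever one is needed.
\<close>

lemma approximate_strong_duality:
  fixes v :: "nat \<Rightarrow> real"
  assumes nonempty: "described_set n m A b \<noteq> {}"
    and bound: "\<And>x. x \<in> described_set n m A b \<Longrightarrow> (\<Sum>e<n. v e * coord x e) \<le> M"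
    and "0 < \<epsilon>"
  shows "\<exists>y. (\<forall>i<m. 0 \<le> y i) \<and> (\<forall>e<n. v e \<le> (\<Sum>i<m. A i e * y i)) \<and> (\<Sum>i<m. b i * y i) \<le> M + \<epsilon>"
proof -
  \<comment> \<open>The rows of \<open>A\<close>, the sign constraints \<open>- x e \<le> 0\<close>,
    and the claim that the objective reaches \<open>M + \<epsilon>\<close>. By \<open>bound\<close>
    these are jointly infeasible.\<close>
  define F where "F = (\<lambda>i. (A i, b i)) ` {..<m} \<union>
    (\<lambda>e. (\<lambda>f. if f = e then - 1 else 0 :: real, 0)) ` {..<n} \<union> {(\<lambda>e. - v e, - (M + \<epsilon>))}"
  have "\<not> (\<forall>(a, \<beta>)\<in>F. (\<Sum>e<n. a e * x e) \<le> \<beta>)" for x :: "nat \<Rightarrow> real"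
  proof
    assume "\<forall>(a, \<beta>)\<in>F. (\<Sum>e<n. a e * x e) \<le> \<beta>"
    then have x: "(\<Sum>e<n. a e * x e) \<le> \<beta>" if "(a, \<beta>) \<in> F" for a \<beta>
      using that by auto
    obtain p where p: "Poly_Mapping.keys p \<subseteq> {..<n}" "\<forall>e<n. coord p e = x e"
      using exists_point by blast
    have "0 \<le> x e" if "e < n" for e
    proof -
      have "(\<lambda>f. if f = e then - 1 else 0, 0) \<in> F" using that by (auto simp: F_def)
      from x[OF this] have "(\<Sum>f<n. if f = e then - x f else 0) \<le> 0"
        by (simp add: if_distrib[of "\<lambda>y. y * _"] cong: if_cong)
      then show ?thesis using that by simp
    qed
    moreover have "(\<Sum>e<n. A i e * x e) \<le> b i" if "i < m" for i
    proof -
      have "(A i, b i) \<in> F" using that by (auto simp: F_def)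
      from x[OF this] show ?thesis .
    qed
    ultimately have "p \<in> described_set n m A b"
      using p by (auto simp: described_set_def nonneg_orthant_def)
    from bound[OF this] have "(\<Sum>e<n. v e * x e) \<le> M" using p by simp
    moreover have "(\<lambda>e. - v e, - (M + \<epsilon>)) \<in> F" by (simp add: F_def)
    from x[OF this] have "(\<Sum>e<n. - v e * x e) \<le> - (M + \<epsilon>)" .
    ultimately show False using \<open>0 < \<epsilon>\<close> by (simp add: sum_negf)
  qed
  moreover have "finite F" by (auto simp: F_def)
  ultimately obtain a \<beta> where a: "(a, \<beta>) \<in> nonneg_combinations F" "\<forall>e<n. a e = 0" "\<beta> < 0"
    using farkas[of F n] by blast
  \<comment> \<open>\<open>y\<close>, \<open>z\<close> and \<open>t\<close> are the multipliers of
    the rows, of the sign constraints and of the objective constraint.\<close>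
  define rep where "rep y z t a \<beta> \<longleftrightarrow>
      (\<forall>i<m. 0 \<le> y i) \<and> (\<forall>e<n. 0 \<le> z e) \<and> 0 \<le> t \<and>
      (\<forall>e<n. a e = (\<Sum>i<m. A i e * y i) - z e - t * v e) \<and>
      \<beta> = (\<Sum>i<m. b i * y i) - t * (M + \<epsilon>)" for y z :: "nat \<Rightarrow> real" and t a \<beta>
  have "\<exists>y z t. rep y z t a \<beta>"
    using a(1)
  proof induction
    case (base a \<beta>)
    then consider i where "i < m" "a = A i" "\<beta> = b i"
      | f where "f < n" "a = (\<lambda>e. if e = f then - 1 else 0)" "\<beta> = 0"
      | "a = (\<lambda>e. - v e)" "\<beta> = - (M + \<epsilon>)"
      by (auto simp: F_def)
    then show ?case
    proof cases
      case 1
      then have "rep (\<lambda>j. if j = i then 1 else 0) (\<lambda>_. 0) 0 a \<beta>"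
        by (simp add: rep_def if_distrib cong: if_cong)
      then show ?thesis by blast
    next
      case 2
      then have "rep (\<lambda>_. 0) (\<lambda>e. if e = f then 1 else 0) 0 a \<beta>"
        by (simp add: rep_def)
      then show ?thesis by blast
    next
      case 3
      then have "rep (\<lambda>_. 0) (\<lambda>_. 0) 1 a \<beta>"
        by (simp add: rep_def)
      then show ?thesis by blast
    qed
  next
    case (add a \<beta> a' \<beta>')
    then obtain y z t y' z' t' where "rep y z t a \<beta>" "rep y' z' t' a' \<beta>'" by blast
    then have "rep (\<lambda>i. y i + y' i) (\<lambda>e. z e + z' e) (t + t') (\<lambda>e. a e + a' e) (\<beta> + \<beta>')"
      by (auto simp: rep_def sum.distrib distrib_left distrib_right)
    then show ?case by blast
  next
    case (scale a \<beta> r)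
    then obtain y z t where "rep y z t a \<beta>" by blast
    with \<open>0 \<le> r\<close> have "rep (\<lambda>i. r * y i) (\<lambda>e. r * z e) (r * t) (\<lambda>e. r * a e) (r * \<beta>)"
      by (auto simp: rep_def sum_distrib_left right_diff_distrib mult.left_commute mult.assoc)
    then show ?case by blast
  qed
  then obtain y z t where "rep y z t a \<beta>" by blast
  then have y: "\<And>i. i < m \<Longrightarrow> 0 \<le> y i" and z: "\<And>e. e < n \<Longrightarrow> 0 \<le> z e" and "0 \<le> t"
    and rows: "\<And>e. e < n \<Longrightarrow> 0 = (\<Sum>i<m. A i e * y i) - z e - t * v e"
    and neg: "(\<Sum>i<m. b i * y i) < t * (M + \<epsilon>)"
    using a(2,3) unfolding rep_def by auto
  \<comment> \<open>With \<open>t = 0\<close> the certificate would refute the rows and sign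
    constraints alone, although the described set has a point. So \<open>t\<close> is positive and
    \<open>y / t\<close> is the desired dual solution.\<close>
  have "t \<noteq> 0"
  proof
    assume "t = 0"
    obtain x where x: "x \<in> described_set n m A b" using nonempty by blast
    then have x0: "\<And>e. e < n \<Longrightarrow> 0 \<le> coord x e" and Ax: "\<And>i. i < m \<Longrightarrow> (\<Sum>e<n. A i e * coord x e) \<le> b i"
      by (auto simp: described_set_def nonneg_orthant_def)
    have "0 \<le> (\<Sum>e<n. z e * coord x e)"
      using z x0 by (intro sum_nonneg) auto
    also have "\<dots> = (\<Sum>e<n. (\<Sum>i<m. A i e * y i) * coord x e)"
      using rows \<open>t = 0\<close> by (intro sum.cong) auto
    also have "\<dots> = (\<Sum>i<m. (\<Sum>e<n. A i e * coord x e) * y i)"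
      unfolding sum_distrib_right by (subst sum.swap) (simp add: mult_ac)
    also have "\<dots> \<le> (\<Sum>i<m. b i * y i)"
      using Ax y by (intro sum_mono mult_right_mono) auto
    finally show False using neg \<open>t = 0\<close> by simp
  qed
  with \<open>0 \<le> t\<close> have "0 < t" by simp
  have div: "(\<Sum>i<m. d i * (y i / t)) = (\<Sum>i<m. d i * y i) / t" for d
    by (simp add: sum_divide_distrib)
  show ?thesis
  proof (intro exI[of _ "\<lambda>i. y i / t"] conjI allI impI)
    fix e assume "e < n"
    from rows[OF this] z[OF this] have "t * v e \<le> (\<Sum>i<m. A i e * y i)" by simp
    then show "v e \<le> (\<Sum>i<m. A i e * (y i / t))"
      unfolding div using \<open>0 < t\<close> by (simp add: field_simps)
  next
    show "(\<Sum>i<m. b i * (y i / t)) \<le> M + \<epsilon>"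
      unfolding div using \<open>0 < t\<close> neg by (simp add: field_simps)
  qed (use y \<open>0 < t\<close> in auto)
qed

text \<open>A generating set of least cardinality consists of extreme points, since a generator in
  the hull of the others could be dropped; a linear function is maximal at one of its elements. The
  argument is purely algebraic, so it applies to the infinite-dimensional type
  \<open>point\<close>.\<close>

lemma polytope_has_maximal_extreme_point:
  fixes f :: "'a::real_vector \<Rightarrow> real"
  assumes "polytope P" "P \<noteq> {}" "linear f"
  shows "\<exists>v. v extreme_point_of P \<and> (\<forall>x\<in>P. f x \<le> f v)"
proof -
  define \<V> where "\<V> = {V. finite V \<and> P = convex hull V}"
  obtain V0 where "V0 \<in> \<V>" using assms(1) by (auto simp: polytope_def \<V>_def)
  then obtain V where V: "V \<in> \<V>" and min: "\<And>W. W \<in> \<V> \<Longrightarrow> card V \<le> card W"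
    using ex_has_least_nat[of "\<lambda>V. V \<in> \<V>" V0 card] by blast
  then have fin: "finite V" and P: "P = convex hull V" by (auto simp: \<V>_def)
  have ext: "v extreme_point_of P" if "v \<in> V" for v
  proof -
    have "v \<notin> convex hull (V - {v})"
    proof
      assume "v \<in> convex hull (V - {v})"
      then have "convex hull (insert v (V - {v})) = convex hull (V - {v})"
        by (metis hull_redundant)
      then have "V - {v} \<in> \<V>" using fin P that by (simp add: \<V>_def insert_absorb)
      then have "card V \<le> card (V - {v})" by (rule min)
      with that fin show False by (metis card_Diff1_less leD)
    qed
    then have "v extreme_point_of (convex hull (insert v (V - {v})))"
      using fin by (intro extreme_point_of_convex_hull_insert) auto
    then show ?thesis using that P by (simp add: insert_absorb)
  qed
  have "V \<noteq> {}" using assms(2) P by auto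
  then obtain v where v: "v \<in> V" "\<And>x. x \<in> V \<Longrightarrow> f x \<le> f v"
    using obtains_MAX[OF fin, of f] by (metis Max_ge fin finite_imageI imageI)
  have "convex {x. f x \<le> f v}"
    using convex_linear_vimage[OF assms(3), of "{..f v}"] by (simp add: vimage_def)
  then have "P \<subseteq> {x. f x \<le> f v}"
    unfolding P using v by (intro hull_minimal) auto
  then show ?thesis using ext v by blast
qed

section \<open>Lagrangian relaxation of the budget\<close>

text \<open>The penalty for using an interdicted element is one unit per unit of its coordinate,
  exactly the loss that \<open>w_down_closed\<close> permits when this coordinate is zeroed.\<close>

definition penalized_objective :: "nat \<Rightarrow> (nat \<Rightarrow> int) \<Rightarrow> nat set \<Rightarrow> point \<Rightarrow> real" where
  "penalized_objective n w R x = (\<Sum>e<n. (real_of_int (w e) - of_bool (e \<in> R)) * coord x e)"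

lemma linear_penalized_objective: "linear (penalized_objective n w R)"
  by (rule linearI)
     (simp_all add: penalized_objective_def lookup_add scaleR_poly_mapping_def distrib_left
       sum.distrib sum_distrib_left mult.left_commute)

lemma penalized_objective_empty: "penalized_objective n w {} = objective n w"
  by (simp add: penalized_objective_def objective_def fun_eq_iff)

lemma penalized_objective_insert:
  assumes "e \<notin> R" "e < n"
  shows "penalized_objective n w (insert e R) x = penalized_objective n w R x - coord x e"
proof -
  have "penalized_objective n w (insert e R) x =
      (\<Sum>f<n. (real_of_int (w f) - of_bool (f \<in> R)) * coord x f - (if f = e then coord x f else 0))"
    unfolding penalized_objective_def using assms by (intro sum.cong) (auto simp: algebra_simps)
  then show ?thesis
    using assms by (simp add: sum_subtractf penalized_objective_def)
qed

lemma penalized_objective_eq_objective: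
  assumes "\<forall>e\<in>R. coord x e = 0"
  shows "penalized_objective n w R x = objective n w x"
  unfolding penalized_objective_def objective_def using assms
  by (intro sum.cong) (auto simp: of_bool_def)

section \<open>Interdicted values as penalized maxima\<close>

locale interdiction_problem =
  fixes n :: nat and X :: "point set" and w c :: "nat \<Rightarrow> int" and B :: int
    and m :: nat and A :: "nat \<Rightarrow> nat \<Rightarrow> real" and b :: "nat \<Rightarrow> real"
  assumes instance_X: "interdiction_instance n X c B"
    and down_closed: "w_down_closed n w X"
    and description: "described_set n m A b = convex hull X"
begin

abbreviation "\<nu> \<equiv> interdicted_value n w X"
abbreviation "pen \<equiv> penalized_objective n w"

lemma X_nonneg: "x \<in> X \<Longrightarrow> e < n \<Longrightarrow> 0 \<le> coord x e"
  and c_pos: "e < n \<Longrightarrow> 0 < c e"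
  and B_pos: "0 < B"
  using instance_X by (auto simp: interdiction_instance_def nonneg_orthant_def)

lemma cost_nonneg: "R \<subseteq> {..<n} \<Longrightarrow> 0 \<le> sum c R"
  by (intro sum_nonneg) (use c_pos in force)

lemma cost_le_total: "R \<subseteq> {..<n} \<Longrightarrow> sum c R \<le> sum c {..<n}"
  by (intro sum_mono2) (use c_pos in force)+

text \<open>The elements of \<open>R\<close> are zeroed one after the other. Each step loses at most
  the current coordinate, hence at most the original one, which is what the penalty charges. Zeros
  already created survive because coordinates only decrease and stay nonnegative.\<close>

lemma zero_out:
  assumes "R \<subseteq> {..<n}" "x \<in> X"
  shows "\<exists>x'\<in>X. (\<forall>f<n. coord x' f \<le> coord x f) \<and> (\<forall>e\<in>R. coord x' e = 0) \<and>
    pen R x \<le> objective n w x'"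
proof -
  have "finite R" using assms(1) finite_subset by blast
  then show ?thesis using assms(1)
  proof induction
    case empty
    then show ?case
      using assms(2) by (intro bexI[of _ x]) (auto simp: penalized_objective_empty)
  next
    case (insert e R)
    then obtain x' where x': "x' \<in> X" "\<forall>f<n. coord x' f \<le> coord x f" "\<forall>e\<in>R. coord x' e = 0"
      "pen R x \<le> objective n w x'" by auto
    have e: "e < n" using insert by auto
    show ?case
    proof (cases "coord x' e = 0")
      case True
      then show ?thesis
        using x' insert e X_nonneg[OF assms(2) e]
        by (intro bexI[of _ x']) (auto simp: penalized_objective_insert)
    next
      case False
      with X_nonneg[OF x'(1) e] have "0 < coord x' e" by simp
      then obtain x'' where x'': "x'' \<in> X" "\<forall>f<n. coord x'' f \<le> coord x' f" "coord x'' e = 0"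
        "objective n w x'' \<ge> objective n w x' - coord x' e"
        using down_closed x'(1) e unfolding w_down_closed_def by blast
      have "coord x'' f = 0" if "f \<in> R" for f
      proof -
        have "f < n" using that insert.prems by auto
        then show ?thesis
          using x''(2) x'(3) that X_nonneg[OF x''(1)] by (metis antisym)
      qed
      moreover have "pen (insert e R) x \<le> objective n w x''"
      proof -
        have "coord x' e \<le> coord x e" using x'(2) e by blast
        then show ?thesis
          using x''(4) x'(4) insert.hyps e by (simp add: penalized_objective_insert)
      qed
      ultimately show ?thesis
        using x''(1,2,3) x'(2) by (intro bexI[of _ x'']) (auto intro: order_trans)
    qed
  qed
qed

lemma zero_in_X: "\<exists>x\<in>X. \<forall>e<n. coord x e = 0"
proof -
  obtain x where "x \<in> X" using instance_X by (auto simp: interdiction_instance_def)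
  from zero_out[OF order_refl this] show ?thesis by auto
qed

text \<open>
  The penalized maximum is attained at an integral vertex \<open>v\<close>, and zeroing out \<open>v\<close> on \<open>R\<close> yields a
  point that attains the interdicted value.
\<close>

lemma interdicted_value_is_max:
  assumes R: "R \<subseteq> {..<n}"
  shows "\<exists>v\<in>X. \<nu> R = pen R v \<and> \<nu> R \<in> \<int> \<and> (\<forall>x\<in>convex hull X. pen R x \<le> pen R v)"
proof -
  have "polytope (convex hull X)" "convex hull X \<noteq> {}"
    and int: "\<And>v e. v extreme_point_of (convex hull X) \<Longrightarrow> coord v e \<in> \<int>"
    using instance_X by (auto simp: interdiction_instance_def integral_polytope_def)
  from polytope_has_maximal_extreme_point[OF this(1,2) linear_penalized_objective[of n w R]]
  obtain v where v: "v extreme_point_of (convex hull X)" "\<forall>x\<in>convex hull X. pen R x \<le> pen R v"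
    by blast
  have vX: "v \<in> X" using extreme_point_of_convex_hull v(1) by blast
  obtain v' where v': "v' \<in> X" "\<forall>e\<in>R. coord v' e = 0" "pen R v \<le> objective n w v'"
    using zero_out[OF R vX] by blast
  have upper: "objective n w x \<le> pen R v" if "x \<in> X" "\<forall>e\<in>R. coord x e = 0" for x
    using v(2) that penalized_objective_eq_objective[of R x n w] by (metis hull_inc)
  have "\<nu> R = pen R v"
    unfolding interdicted_value_def
  proof (rule cSup_eq_maximum)
    have "objective n w v' = pen R v" using upper v' by fastforce
    then show "pen R v \<in> objective n w ` {x \<in> X. \<forall>e\<in>R. coord x e = 0}"
      using v' by force
  qed (use upper in auto)
  moreover have "pen R v \<in> \<int>"
    unfolding penalized_objective_def using int[OF v(1)]
    by (intro Ints_sum Ints_mult Ints_diff) (auto simp: of_bool_def)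
  ultimately show ?thesis using vX v(2) by auto
qed

lemma interdicted_value_Ints: "R \<subseteq> {..<n} \<Longrightarrow> \<nu> R \<in> \<int>"
  using interdicted_value_is_max by blast

lemma penalized_objective_le: "R \<subseteq> {..<n} \<Longrightarrow> x \<in> convex hull X \<Longrightarrow> pen R x \<le> \<nu> R"
  using interdicted_value_is_max[of R] by auto

lemma interdicted_value_nonneg: "R \<subseteq> {..<n} \<Longrightarrow> 0 \<le> \<nu> R"
proof -
  assume R: "R \<subseteq> {..<n}"
  obtain x where "x \<in> X" "\<forall>e<n. coord x e = 0" using zero_in_X by blast
  with penalized_objective_le[OF R hull_inc, of x] show ?thesis
    by (simp add: penalized_objective_def)
qed

text \<open>Connects the quantity in \<open>input_size\<close> with the value of the empty
  interdiction set, so that the input length controls the range of useful multipliers.\<close>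

lemma interdicted_value_empty: "\<nu> {} = Sup (objective n w ` described_set n m A b)"
proof -
  obtain v where v: "v \<in> X" "\<nu> {} = objective n w v"
    "\<forall>x\<in>convex hull X. objective n w x \<le> objective n w v"
    using interdicted_value_is_max[of "{}"] by (auto simp: penalized_objective_empty)
  have "Sup (objective n w ` described_set n m A b) = objective n w v"
    unfolding description using v by (intro cSup_eq_maximum) (auto simp: hull_inc)
  with v show ?thesis by simp
qed

lemma OPT_attained:
  "\<exists>R. R \<subseteq> {..<n} \<and> sum c R \<le> B \<and> OPT n w X c B = \<nu> R"
proof -
  let ?\<R> = "{R. R \<subseteq> {..<n} \<and> sum c R \<le> B}"
  have "finite ?\<R>" by (rule finite_subset[of _ "Pow {..<n}"]) auto
  moreover have "{} \<in> ?\<R>" using B_pos by simp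
  ultimately have "OPT n w X c B \<in> \<nu> ` ?\<R>"
    unfolding OPT_def by (intro Min_in) auto
  then show ?thesis by auto
qed

section \<open>Minimizers of the Lagrangian\<close>

definition lagrangian_optimal :: "real \<Rightarrow> nat set \<Rightarrow> bool" where
  "lagrangian_optimal l R \<longleftrightarrow> R \<subseteq> {..<n} \<and>
     (\<forall>R'. R' \<subseteq> {..<n} \<longrightarrow> \<nu> R + l * sum c R \<le> \<nu> R' + l * sum c R')"

text \<open>Weak Lagrangian duality: compare \<open>R\<close> with an optimal set, whose cost is at
  most \<open>B\<close>.\<close>

lemma lagrangian_optimal_le_OPT:
  assumes "lagrangian_optimal l R" "0 \<le> l"
  shows "\<nu> R + l * sum c R \<le> OPT n w X c B + l * B"
proof -
  obtain R' where R': "R' \<subseteq> {..<n}" "sum c R' \<le> B" "OPT n w X c B = \<nu> R'"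
    using OPT_attained by blast
  then have "\<nu> R + l * sum c R \<le> \<nu> R' + l * sum c R'"
    using assms(1) by (auto simp: lagrangian_optimal_def)
  also have "l * sum c R' \<le> l * B"
    using R'(2) assms(2) by (intro mult_left_mono) (auto simp flip: of_int_sum)
  finally show ?thesis using R'(3) by simp
qed

text \<open>
  The dual solution \<open>r\<close> for the upper bounds \<open>u = l c\<close> may be replaced by the indicator vector of its
  support without increasing the dual objective.
\<close>

lemma dual_optimal_lagrangian_optimal:
  fixes r :: "nat \<Rightarrow> int"
  assumes opt: "dual_optimal n m A b w (\<lambda>e. l * real_of_int (c e)) y (\<lambda>e. real_of_int (r e))"
    and l: "0 \<le> l"
  shows "lagrangian_optimal l {e. e < n \<and> 0 < r e}"
proof -
  let ?R = "{e. e < n \<and> 0 < r e}"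
  have y: "\<And>i. i < m \<Longrightarrow> 0 \<le> y i" and r: "\<And>e. e < n \<Longrightarrow> 0 \<le> r e"
    and feas: "\<And>e. e < n \<Longrightarrow> real_of_int (w e) \<le> (\<Sum>i<m. A i e * y i) + real_of_int (r e)"
    using opt by (auto simp: dual_optimal_def dual_feasible_def)
  let ?obj = "dual_objective n m b (\<lambda>e. l * real_of_int (c e))"
  \<comment> \<open>Weak duality restricted to points vanishing on \<open>?R\<close>: each product
    \<open>r e * coord x e\<close> is zero, so \<open>y\<close> alone bounds the interdicted
    value.\<close>
  have value_le: "\<nu> ?R \<le> (\<Sum>i<m. b i * y i)"
    unfolding interdicted_value_def
  proof (rule cSup_least)
    show "objective n w ` {x \<in> X. \<forall>e\<in>?R. coord x e = 0} \<noteq> {}"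
      using zero_in_X by force
    fix z assume "z \<in> objective n w ` {x \<in> X. \<forall>e\<in>?R. coord x e = 0}"
    then obtain x where x: "x \<in> X" "\<forall>e\<in>?R. coord x e = 0" "z = objective n w x" by auto
    then have "x \<in> described_set n m A b" using description by (simp add: hull_inc)
    then have Ax: "\<And>i. i < m \<Longrightarrow> (\<Sum>e<n. A i e * coord x e) \<le> b i"
      by (auto simp: described_set_def)
    have "objective n w x \<le> (\<Sum>e<n. ((\<Sum>i<m. A i e * y i) + real_of_int (r e)) * coord x e)"
      unfolding objective_def using feas X_nonneg[OF x(1)]
      by (intro sum_mono mult_right_mono) auto
    also have "\<dots> = (\<Sum>e<n. (\<Sum>i<m. A i e * y i) * coord x e)"
    proof (intro sum.cong refl)
      fix e assume "e \<in> {..<n}"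
      then have "real_of_int (r e) * coord x e = 0"
        using x(2) r[of e] by (cases "r e = 0") auto
      then show "((\<Sum>i<m. A i e * y i) + real_of_int (r e)) * coord x e =
          (\<Sum>i<m. A i e * y i) * coord x e" by (simp add: distrib_right)
    qed
    also have "\<dots> = (\<Sum>i<m. (\<Sum>e<n. A i e * coord x e) * y i)"
      unfolding sum_distrib_right by (subst sum.swap) (simp add: mult_ac)
    also have "\<dots> \<le> (\<Sum>i<m. b i * y i)"
      using Ax y by (intro sum_mono mult_right_mono) auto
    finally show "z \<le> (\<Sum>i<m. b i * y i)" using x(3) by simp
  qed
  have cost_eq: "l * real_of_int (sum c R) = (\<Sum>e<n. l * c e * of_bool (e \<in> R))"
    if "R \<subseteq> {..<n}" for R
  proof -
    have "(\<Sum>e<n. l * c e * of_bool (e \<in> R)) = (\<Sum>e\<in>R. l * c e)"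
      using that by (intro sum.mono_neutral_cong_right) (auto simp: of_bool_def)
    then show ?thesis by (simp add: sum_distrib_left)
  qed
  have "l * real_of_int (sum c ?R) \<le> (\<Sum>e<n. l * c e * r e)"
  proof (subst cost_eq, blast, intro sum_mono mult_left_mono)
    fix e assume e: "e \<in> {..<n}"
    \<comment> \<open>Integrality of \<open>r\<close> enters here: a positive entry is at least
      \<open>1\<close>.\<close>
    then show "of_bool (e \<in> ?R) \<le> real_of_int (r e)"
      using r[of e] by (auto simp: of_bool_def)
    show "0 \<le> l * real_of_int (c e)" using l c_pos[of e] e by auto
  qed
  with value_le have le_obj: "\<nu> ?R + l * real_of_int (sum c ?R) \<le> ?obj y (\<lambda>e. real_of_int (r e))"
    by (simp add: dual_objective_def)
  have "\<nu> ?R + l * sum c ?R \<le> \<nu> R' + l * sum c R'" if R': "R' \<subseteq> {..<n}" for R'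
  \<comment> \<open>An almost optimal dual solution for the weights \<open>w - \<chi>\<close> of
    \<open>R'\<close> becomes feasible for the boxed dual when the indicator of \<open>R'\<close> is
    used as \<open>r\<close>. Its objective is at most
    \<open>\<nu> R' + \<epsilon> + l c(R')\<close>, and \<open>(y, r)\<close> is no worse.\<close>
  proof (rule field_le_epsilon)
    fix \<epsilon> :: real assume \<epsilon>: "0 < \<epsilon>"
    have nonempty: "described_set n m A b \<noteq> {}"
      using instance_X description by (auto simp: interdiction_instance_def)
    have bound: "(\<Sum>e<n. (real_of_int (w e) - of_bool (e \<in> R')) * coord x e) \<le> \<nu> R'"
      if "x \<in> described_set n m A b" for x
      using penalized_objective_le[OF R'] that description by (simp add: penalized_objective_def)
    from approximate_strong_duality[OF nonempty bound \<epsilon>]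
    obtain y' where y': "\<forall>i<m. 0 \<le> y' i"
      "\<forall>e<n. real_of_int (w e) - of_bool (e \<in> R') \<le> (\<Sum>i<m. A i e * y' i)"
      "(\<Sum>i<m. b i * y' i) \<le> \<nu> R' + \<epsilon>" by blast
    have "dual_feasible n m A w y' (\<lambda>e. of_bool (e \<in> R'))"
      using y'(1,2) by (auto simp: dual_feasible_def algebra_simps)
    then have "?obj y (\<lambda>e. real_of_int (r e)) \<le> ?obj y' (\<lambda>e. of_bool (e \<in> R'))"
      using opt by (auto simp: dual_optimal_def)
    also have "\<dots> \<le> \<nu> R' + \<epsilon> + l * sum c R'"
      using y'(3) cost_eq[OF R'] by (simp add: dual_objective_def)
    finally show "\<nu> ?R + l * sum c ?R \<le> \<nu> R' + l * sum c R' + \<epsilon>"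
      using le_obj by simp
  qed
  then show ?thesis by (auto simp: lagrangian_optimal_def)
qed

text \<open>The origin lies in every box, so a correct solver never answers \<open>None\<close> to a
  nonnegative query.\<close>

lemma boxed_set_nonempty:
  assumes "\<forall>e<n. 0 \<le> u e"
  shows "boxed_set n m A b u \<noteq> {}"
proof -
  obtain x where "x \<in> X" "\<forall>e<n. coord x e = 0" using zero_in_X by blast
  then have "x \<in> boxed_set n m A b u"
    using assms description hull_inc[of x X] by (auto simp: boxed_set_def)
  then show ?thesis by blast
qed

text \<open>Costs are integers, so a set of nonzero cost pays at least \<open>l\<close>, which
  exceeds the Lagrangian value \<open>\<nu> {}\<close> of the empty set. This bounds the search
  range.\<close>

lemma lagrangian_optimal_large:
  assumes "lagrangian_optimal l R" "\<nu> {} < l"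
  shows "sum c R = 0"
proof (rule ccontr)
  assume "sum c R \<noteq> 0"
  moreover have R: "R \<subseteq> {..<n}" and "\<nu> R + l * sum c R \<le> \<nu> {} + l * sum c {}"
    using assms(1) by (auto simp: lagrangian_optimal_def)
  ultimately have "1 \<le> real_of_int (sum c R)" "l * sum c R \<le> \<nu> {}"
    using cost_nonneg[OF R] interdicted_value_nonneg[OF R] by (auto simp del: of_int_sum)
  moreover have "0 \<le> l" using assms(2) interdicted_value_nonneg[of "{}"] by simp
  ultimately show False
    using assms(2) mult_left_mono[of 1 "real_of_int (sum c R)" l] by linarith
qed

text \<open>For a set over budget the penalty \<open>l c(R)\<close> already covers
  \<open>l B\<close>; for \<open>l = 0\<close> there is no penalty. Either way weak duality loses
  nothing, which yields the factor \<open>1\<close> on the value for the set at the lower end of the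
  search interval.\<close>

lemma lagrangian_optimal_large_cost:
  assumes "lagrangian_optimal l R" "0 \<le> l" "l = 0 \<or> B < sum c R"
  shows "\<nu> R \<le> OPT n w X c B"
proof (cases "l = 0")
  case True
  then show ?thesis using lagrangian_optimal_le_OPT[OF assms(1,2)] by simp
next
  case False
  then have "l * real_of_int B \<le> l * real_of_int (sum c R)"
    using assms by (intro mult_left_mono) (auto simp del: of_int_sum)
  then show ?thesis using lagrangian_optimal_le_OPT[OF assms(1,2)] by simp
qed

text \<open>
  A convex combination of the two bounds of \<open>lagrangian_optimal_le_OPT\<close> in which the budget terms
  cancel up to less than \<open>1\<close>; integrality removes the error.
\<close>

lemma lagrangian_optimal_pair:
  assumes R1: "lagrangian_optimal (k / D) R1" and R2: "lagrangian_optimal ((k + 1) / D) R2"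
    and k: "0 \<le> k" and D: "D = sum c {..<n} * B + 1" and cost: "B < sum c R1" "sum c R2 \<le> B"
  shows "(B - sum c R2) * \<nu> R1 + (sum c R1 - B) * \<nu> R2 \<le> OPT n w X c B * (sum c R1 - sum c R2)"
proof -
  have sub: "R1 \<subseteq> {..<n}" "R2 \<subseteq> {..<n}" using R1 R2 by (auto simp: lagrangian_optimal_def)
  define p q where "p = B - sum c R2" and "q = sum c R1 - B"
  have p: "0 \<le> p" "p \<le> B" and q: "0 \<le> q" "q \<le> sum c {..<n}"
    using cost cost_nonneg[OF sub(2)] cost_le_total[OF sub(1)] B_pos by (auto simp: p_def q_def)
  have "q * p \<le> sum c {..<n} * B"
    using p q by (intro mult_mono) auto
  then have "q * p < D" using D by simp
  then have qpD: "real_of_int q * p < D" by (metis of_int_less_iff of_int_mult)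
  have "0 < D" using D B_pos cost_nonneg[of "{..<n}"] by simp
  then have "0 < real_of_int D" by simp
  obtain z1 where z1: "\<nu> R1 = of_int z1" using interdicted_value_Ints[OF sub(1)] Ints_cases by blast
  obtain z2 where z2: "\<nu> R2 = of_int z2" using interdicted_value_Ints[OF sub(2)] Ints_cases by blast
  obtain z where z: "OPT n w X c B = of_int z"
    using OPT_attained interdicted_value_Ints Ints_cases by metis
  have l1: "\<nu> R1 + k / D * q \<le> z"
    using lagrangian_optimal_le_OPT[OF R1] k \<open>0 < D\<close> z by (simp add: q_def algebra_simps)
  have l2: "\<nu> R2 - (k + 1) / D * p \<le> z"
    using lagrangian_optimal_le_OPT[OF R2] k \<open>0 < D\<close> z by (simp add: p_def algebra_simps)
  have "real_of_int p * (\<nu> R1 + k / D * q) + q * (\<nu> R2 - (k + 1) / D * p) \<le> p * real_of_int z + q * real_of_int z"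
    using l1 l2 p q by (intro add_mono mult_left_mono) auto
  then have "p * \<nu> R1 + q * \<nu> R2 \<le> (p + q) * real_of_int z + q * p / D"
    by (simp add: algebra_simps add_divide_distrib)
  also have "q * p / D < 1" using qpD \<open>0 < real_of_int D\<close> by simp
  finally have "of_int (p * z1 + q * z2) < (of_int ((p + q) * z + 1) :: real)"
    by (simp add: z1 z2)
  then have "p * z1 + q * z2 \<le> (p + q) * z"
    by (simp only: of_int_less_iff)
  then have "of_int (p * z1 + q * z2) \<le> (of_int ((p + q) * z) :: real)"
    by (simp only: of_int_le_iff)
  then show ?thesis
    by (simp add: z1 z2 z p_def q_def algebra_simps)
qed

text \<open>In \<open>lagrangian_optimal_pair\<close> the nonnegative term of \<open>R1\<close> and
  the cost of \<open>R2\<close> are dropped. The assumption \<open>large\<close> gives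
  \<open>c(R1) \<le> (1 + \<alpha>) (c(R1) - B)\<close>, and the positive factor
  \<open>c(R1) - B\<close> cancels.\<close>

lemma pseudoapproximation:
  assumes R1: "lagrangian_optimal (k / D) R1" and R2: "lagrangian_optimal ((k + 1) / D) R2"
    and k: "0 \<le> k" and D: "D = sum c {..<n} * B + 1" and cost: "sum c R2 \<le> B"
    and \<alpha>: "0 < \<alpha>" and large: "(1 + 1 / \<alpha>) * B < sum c R1"
  shows "\<nu> R2 \<le> (1 + \<alpha>) * OPT n w X c B"
proof -
  have sub: "R1 \<subseteq> {..<n}" "R2 \<subseteq> {..<n}" using R1 R2 by (auto simp: lagrangian_optimal_def)
  have "1 * real_of_int B \<le> (1 + 1 / \<alpha>) * B"
    using \<alpha> B_pos by (intro mult_right_mono) auto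
  with large have "B < sum c R1" by linarith
  from lagrangian_optimal_pair[OF R1 R2 k D this cost]
  have pair: "(B - sum c R2) * \<nu> R1 + (sum c R1 - B) * \<nu> R2 \<le> OPT n w X c B * (sum c R1 - sum c R2)" .
  have OPT: "0 \<le> OPT n w X c B" using OPT_attained interdicted_value_nonneg by metis
  have "0 \<le> (B - sum c R2) * \<nu> R1"
    using cost interdicted_value_nonneg[OF sub(1)] by (intro mult_nonneg_nonneg) (auto simp del: of_int_sum)
  with pair have "(sum c R1 - B) * \<nu> R2 \<le> OPT n w X c B * (sum c R1 - sum c R2)" by linarith
  also have "\<dots> \<le> OPT n w X c B * sum c R1"
    using OPT cost_nonneg[OF sub(2)] by (intro mult_left_mono) (auto simp del: of_int_sum)
  also have "real_of_int (sum c R1) \<le> (1 + \<alpha>) * (sum c R1 - B)"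
    using large \<alpha> by (simp add: field_simps)
  then have "OPT n w X c B * sum c R1 \<le> OPT n w X c B * ((1 + \<alpha>) * (sum c R1 - B))"
    using OPT by (intro mult_left_mono) auto
  finally have "real_of_int (sum c R1 - B) * \<nu> R2 \<le> real_of_int (sum c R1 - B) * ((1 + \<alpha>) * OPT n w X c B)"
    by (simp add: mult_ac)
  then show ?thesis using \<open>B < sum c R1\<close> by (subst (asm) mult_le_cancel_left_pos) (auto simp del: of_int_sum)
qed

end

section \<open>Reasoning about bit lengths and running times\<close>

text \<open>The bound \<open>2 ^ h\<close> itself has \<open>h + 1\<close> binary digits, and
  \<open>bits\<close> adds one more.\<close>

lemma bits_le: "\<bar>k\<bar> \<le> 2 ^ h \<Longrightarrow> bits k \<le> h + 2"
proof -
  assume "\<bar>k\<bar> \<le> 2 ^ h"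
  also have "(2 :: int) ^ h < 2 ^ Suc h" by simp
  finally have "nat \<bar>k\<bar> < 2 ^ Suc h" by (simp add: nat_less_iff)
  then have "floorlog 2 (nat \<bar>k\<bar>) \<le> Suc h" by (intro floorlog_leI) auto
  then show ?thesis by (simp add: bits_def)
qed

lemma abs_less_two_power_bits: "\<bar>k\<bar> < 2 ^ bits k"
proof -
  have "nat \<bar>k\<bar> < 2 ^ floorlog 2 (nat \<bar>k\<bar>)" by (rule floorlog_leD) auto
  then have "\<bar>k\<bar> < 2 ^ floorlog 2 (nat \<bar>k\<bar>)" by (simp add: nat_less_iff)
  also have "\<dots> \<le> 2 ^ bits k" by (intro power_increasing) (auto simp: bits_def)
  finally show ?thesis .
qed

lemma bits_pos: "1 \<le> bits k"
  by (simp add: bits_def)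

lemma bits_mono: "\<bar>k\<bar> \<le> \<bar>l\<bar> \<Longrightarrow> bits k \<le> bits l"
  by (simp add: bits_def floorlog_mono nat_mono)

text \<open>Induction on the bound increased by one: the product of \<open>\<bar>a\<bar> + 1\<close>
  and \<open>\<bar>b\<bar> + 1\<close> exceeds \<open>\<bar>a + b\<bar>\<close>, so adding numbers
  costs no more than concatenating their encodings.\<close>

lemma abs_sum_less_two_power_bits:
  "\<bar>\<Sum>e<(n::nat). f e\<bar> < 2 ^ (\<Sum>e<n. bits (f e))"
proof (induction n)
  case (Suc n)
  have "\<bar>f n\<bar> + 1 \<le> 2 ^ bits (f n)" using abs_less_two_power_bits[of "f n"] by simp
  moreover have "\<bar>\<Sum>e<n. f e\<bar> + 1 \<le> 2 ^ (\<Sum>e<n. bits (f e))" using Suc by simp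
  ultimately have "(\<bar>\<Sum>e<n. f e\<bar> + 1) * (\<bar>f n\<bar> + 1) \<le> 2 ^ (\<Sum>e<n. bits (f e)) * 2 ^ bits (f n)"
    by (intro mult_mono) auto
  moreover have "\<bar>(\<Sum>e<n. f e) + f n\<bar> < (\<bar>\<Sum>e<n. f e\<bar> + 1) * (\<bar>f n\<bar> + 1)"
  proof -
    have "0 \<le> \<bar>\<Sum>e<n. f e\<bar> * \<bar>f n\<bar>" by simp
    then show ?thesis
      using abs_triangle_ineq[of "\<Sum>e<n. f e" "f n"] unfolding distrib_left distrib_right by linarith
  qed
  ultimately show ?case by (simp add: power_add)
qed simp

text \<open>The program writes unreduced fractions, while the solver's time is measured on reduced
  ones; reduction only shortens numerator and denominator.\<close>

lemma rat_bits_Fract_le: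
  assumes "0 \<le> k" "0 < d"
  shows "rat_bits (Fract k d) \<le> bits k + bits d"
proof -
  have "quotient_of (Fract k d) = (k div gcd k d, d div gcd k d)"
    using assms by (simp add: quotient_of_Fract normalize_def Let_def)
  moreover have "bits (a div gcd k d) \<le> bits a" if "0 \<le> a" for a
    using that assms zdiv_mono2[of a 1 "gcd k d"]
    by (intro bits_mono) (simp add: pos_imp_zdiv_nonneg_iff int_one_le_iff_zero_less)
  ultimately show ?thesis using assms by (simp add: rat_bits_def add_mono)
qed

section \<open>Cost of evaluating expressions\<close>

fun operations :: "exp \<Rightarrow> nat" where
  "operations (Const k) = 1"
| "operations (Cell a i) = operations i + 1"
| "operations (Plus e f) = operations e + operations f + 1"
| "operations (Minus e f) = operations e + operations f + 1"
| "operations (Times e f) = operations e + operations f + 1"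
| "operations (Div e f) = operations e + operations f + 1"

text \<open>Controls all intermediate results in the given memory. The cost of an expression is then
  at most \<open>2 * h\<close> per operation, whatever the data.\<close>

fun values_within :: "nat \<Rightarrow> exp \<Rightarrow> mem \<Rightarrow> bool" where
  "values_within h (Const k) s \<longleftrightarrow> bits k \<le> h"
| "values_within h (Cell a i) s \<longleftrightarrow> values_within h i s \<and> bits (s a (eval i s)) \<le> h"
| "values_within h (Plus e f) s \<longleftrightarrow>
     values_within h e s \<and> values_within h f s \<and> bits (eval e s + eval f s) \<le> h"
| "values_within h (Minus e f) s \<longleftrightarrow>
     values_within h e s \<and> values_within h f s \<and> bits (eval e s - eval f s) \<le> h"
| "values_within h (Times e f) s \<longleftrightarrow>
     values_within h e s \<and> values_within h f s \<and> bits (eval e s * eval f s) \<le> h"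
| "values_within h (Div e f) s \<longleftrightarrow>
     values_within h e s \<and> values_within h f s \<and> bits (eval e s div eval f s) \<le> h"

lemma bits_eval_le: "values_within h e s \<Longrightarrow> bits (eval e s) \<le> h"
  by (cases e) auto

lemma cost_le: "values_within h e s \<Longrightarrow> cost e s \<le> 2 * h * operations e"
proof (induction e)
  case (Cell a i)
  then show ?case using bits_eval_le[of h i s] by (auto simp: algebra_simps)
next
  case (Plus e f)
  then show ?case using bits_eval_le[of h e s] bits_eval_le[of h f s] by (auto simp: algebra_simps)
next
  case (Minus e f)
  then show ?case using bits_eval_le[of h e s] bits_eval_le[of h f s] by (auto simp: algebra_simps)
next
  case (Times e f)
  then show ?case using bits_eval_le[of h e s] bits_eval_le[of h f s] by (auto simp: algebra_simps)
next
  case (Div e f)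
  then show ?case using bits_eval_le[of h e s] bits_eval_le[of h f s] by (auto simp: algebra_simps)
qed simp

lemma poly_mono_nat: "x \<le> y \<Longrightarrow> poly p x \<le> poly p (y :: nat)"
  by (induction p) (auto intro!: add_mono mult_mono)

section \<open>Total-correctness triples with a time bound\<close>

definition runs ::
  "nat \<Rightarrow> solver \<Rightarrow> solver_time \<Rightarrow> com \<Rightarrow> mem \<Rightarrow> nat \<Rightarrow> (mem \<Rightarrow> bool) \<Rightarrow> bool" where
  "runs n S T P s t Q \<longleftrightarrow> (\<exists>t' s'. exec n S T P s t' s' \<and> t' \<le> t \<and> Q s')"

lemma runs_mono:
  "runs n S T P s t Q \<Longrightarrow> t \<le> t' \<Longrightarrow> (\<And>s'. Q s' \<Longrightarrow> Q' s') \<Longrightarrow> runs n S T P s t' Q'"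
  unfolding runs_def by (meson order_trans)

lemma runs_Skip: "Q s \<Longrightarrow> 1 \<le> t \<Longrightarrow> runs n S T Skip s t Q"
  unfolding runs_def by (blast intro: exec.Skip)

lemma runs_Assign:
  assumes "values_within h i s" "values_within h e s"
    and "2 * h * (operations i + operations e + 1) \<le> t"
    and "Q (s(a := (s a)(eval i s := eval e s)))"
  shows "runs n S T (Assign a i e) s t Q"
proof -
  have "cost i s + cost e s + bits (eval i s) + bits (eval e s) \<le> t"
    using cost_le[OF assms(1)] cost_le[OF assms(2)] bits_eval_le[OF assms(1)] bits_eval_le[OF assms(2)]
      assms(3) by (auto simp: algebra_simps)
  then show ?thesis unfolding runs_def using assms(4) by (blast intro: exec.Assign)
qed

lemma runs_Seq:
  assumes "runs n S T P s t Q" "\<And>s'. Q s' \<Longrightarrow> runs n S T P' s' t' Q'" "t + t' \<le> u"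
  shows "runs n S T (Seq P P') s u Q'"
proof -
  obtain k s' where 1: "exec n S T P s k s'" "k \<le> t" "Q s'" using assms(1) by (auto simp: runs_def)
  from assms(2)[OF this(3)] obtain k' s'' where 2: "exec n S T P' s' k' s''" "k' \<le> t'" "Q' s''"
    by (auto simp: runs_def)
  have "k + k' \<le> u" using 1 2 assms(3) by simp
  with exec.Seq[OF 1(1) 2(1)] 2(3) show ?thesis unfolding runs_def by blast
qed

lemma runs_Assign_Seq:
  assumes "values_within h i s" "values_within h e s"
    and "2 * h * (operations i + operations e + 1) + t \<le> u"
    and "runs n S T P (s(a := (s a)(eval i s := eval e s))) t Q"
  shows "runs n S T (Seq (Assign a i e) P) s u Q"
proof (rule runs_Seq)
  show "runs n S T (Assign a i e) s (2 * h * (operations i + operations e + 1))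
      (\<lambda>s'. s' = s(a := (s a)(eval i s := eval e s)))"
    by (rule runs_Assign[OF assms(1,2)]) auto
qed (use assms in auto)

lemma runs_CallSolver:
  assumes "Q (store_answer (S (query n s)) s)" "1 + query_size n s + T (query n s) \<le> t"
  shows "runs n S T CallSolver s t Q"
  unfolding runs_def using assms by (blast intro: exec.CallSolver)

lemma runs_IfPos:
  assumes "values_within h g s"
    and "h * (2 * operations g + 1) + t \<le> u"
    and "0 < eval g s \<Longrightarrow> runs n S T P s t Q" "\<not> 0 < eval g s \<Longrightarrow> runs n S T P' s t Q"
  shows "runs n S T (IfPos g P P') s u Q"
proof -
  have le: "cost g s + bits (eval g s) + t' \<le> u" if "t' \<le> t" for t'
    using cost_le[OF assms(1)] bits_eval_le[OF assms(1)] assms(2) that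
    by (auto simp: algebra_simps)
  show ?thesis
  proof (cases "0 < eval g s")
    case True
    then obtain t' s' where "exec n S T P s t' s'" "t' \<le> t" "Q s'"
      using assms(3) by (auto simp: runs_def)
    then show ?thesis unfolding runs_def using exec.IfTrue[OF True] le by blast
  next
    case False
    then obtain t' s' where "exec n S T P' s t' s'" "t' \<le> t" "Q s'"
      using assms(4) by (auto simp: runs_def)
    then show ?thesis unfolding runs_def using exec.IfFalse[OF False] le by blast
  qed
qed

text \<open>The index of \<open>I\<close> is a variant bounding the remaining iterations. The loop
  may stop early, so its final value is existential; the factor \<open>k + 1\<close> includes the
  last test of the guard.\<close>

lemma runs_WhilePos:
  assumes within: "\<And>i s. I i s \<Longrightarrow> values_within h g s"
    and body: "\<And>i s. I i s \<Longrightarrow> 0 < eval g s \<Longrightarrow> 0 < i \<and> runs n S T P s t (I (i - 1))"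
    and "I k s"
  shows "runs n S T (WhilePos g P) s ((k + 1) * (h * (2 * operations g + 1) + t))
    (\<lambda>s'. (\<exists>i. I i s') \<and> \<not> 0 < eval g s')"
  using \<open>I k s\<close>
proof (induction k arbitrary: s)
  case 0
  then have "\<not> 0 < eval g s" using body[of 0 s] by auto
  moreover have "cost g s + bits (eval g s) \<le> h * (2 * operations g + 1) + t"
    using cost_le[OF within[OF 0]] bits_eval_le[OF within[OF 0]] by (auto simp: algebra_simps)
  ultimately show ?case
    unfolding runs_def using 0 by (auto intro!: exI exec.WhileFalse)
next
  case (Suc k)
  have guard: "cost g s + bits (eval g s) \<le> h * (2 * operations g + 1)"
    using cost_le[OF within[OF Suc.prems]] bits_eval_le[OF within[OF Suc.prems]]
    by (auto simp: algebra_simps)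
  show ?case
  proof (cases "0 < eval g s")
    case True
    then obtain t1 s1 where 1: "exec n S T P s t1 s1" "t1 \<le> t" "I k s1"
      using body[OF Suc.prems] by (auto simp: runs_def)
    from Suc.IH[OF this(3)] obtain t2 s2 where 2: "exec n S T (WhilePos g P) s1 t2 s2"
      "t2 \<le> (k + 1) * (h * (2 * operations g + 1) + t)" "\<exists>i. I i s2" "\<not> 0 < eval g s2"
      by (auto simp: runs_def)
    have "cost g s + bits (eval g s) + t1 + t2 \<le> (Suc k + 1) * (h * (2 * operations g + 1) + t)"
      using guard 1(2) 2(2) by simp
    then show ?thesis
      unfolding runs_def using exec.WhileTrue[OF True 1(1) 2(1)] 2 by blast
  next
    case False
    have "cost g s + bits (eval g s) \<le> (Suc k + 1) * (h * (2 * operations g + 1) + t)"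
      using guard by simp
    then show ?thesis
      unfolding runs_def using exec.WhileFalse[OF False] Suc.prems False by blast
  qed
qed

section \<open>The algorithm\<close>

text \<open>
  Scalar variables: \<open>0\<close> loop index, \<open>2\<close> cost of the current set, \<open>3\<close> common denominator of all
  multipliers, \<open>4\<close> and \<open>5\<close> numerators of the lower and the upper end of the search interval,
  \<open>6\<close> numerator of the current multiplier.
\<close>

abbreviation var :: "nat \<Rightarrow> exp" where
  "var i \<equiv> Cell (Work i) (Const 0)"

abbreviation set_var :: "nat \<Rightarrow> exp \<Rightarrow> com" where
  "set_var i \<equiv> Assign (Work i) (Const 0)"

abbreviation size_exp :: exp where "size_exp \<equiv> Cell InSize (Const 0)"
abbreviation budget_exp :: exp where "budget_exp \<equiv> Cell InBudget (Const 0)"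
abbreviation alpha_num :: exp where "alpha_num \<equiv> Cell InAlpha (Const 0)"
abbreviation alpha_den :: exp where "alpha_den \<equiv> Cell InAlpha (Const 1)"
abbreviation cost_exp :: exp where "cost_exp \<equiv> Cell InCost (var 0)"

definition for_each :: "com \<Rightarrow> com" where
  "for_each P = Seq (set_var 0 (Const 0))
     (WhilePos (Minus size_exp (var 0)) (Seq P (set_var 0 (Plus (var 0) (Const 1)))))"

definition write_query :: com where
  "write_query = for_each
     (Seq (Assign QueryNum (var 0) (Times (var 6) cost_exp)) (Assign QueryDen (var 0) (var 3)))"

text \<open>Every entry of \<open>Out\<close> is rewritten, zeros included, because earlier rounds
  leave their sets behind.\<close>

definition read_answer :: com where
  "read_answer = Seq (set_var 2 (Const 0)) (for_each
     (IfPos (Cell AnsDual (var 0))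
       (Seq (Assign Out (var 0) (Const 1)) (set_var 2 (Plus (var 2) cost_exp)))
       (Assign Out (var 0) (Const 0))))"

definition solve :: com where
  "solve = Seq write_query (Seq CallSolver read_answer)"

definition initialize :: com where
  "initialize = Seq (for_each (set_var 2 (Plus (var 2) cost_exp)))
     (Seq (set_var 3 (Plus (Times (var 2) budget_exp) (Const 1))) (set_var 6 (Const 1)))"

definition double :: com where
  "double = Seq solve (WhilePos (Minus (var 2) budget_exp) (Seq (set_var 6 (Plus (var 6) (var 6))) solve))"

text \<open>The lower end \<open>var 4\<close> is not assigned beforehand: the search relies on the
  zero-initialized memory to start at multiplier \<open>0\<close>.\<close>

definition bisect :: com where
  "bisect = Seq (set_var 5 (var 6))
     (WhilePos (Minus (Minus (var 5) (var 4)) (Const 1))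
       (Seq (set_var 6 (Div (Plus (var 4) (var 5)) (Const 2)))
         (Seq solve (IfPos (Minus (var 2) budget_exp) (set_var 4 (var 6)) (set_var 5 (var 6))))))"

text \<open>The test is \<open>c(R) > (1 + 1 / \<alpha>) B\<close>, cleared of denominators. The
  last search step may have left the set of either end in \<open>Out\<close>, so the lower end is
  solved again first, and the upper end only if the test succeeds.\<close>

definition select :: com where
  "select = Seq (set_var 6 (var 4)) (Seq solve
     (IfPos (Minus (Times (var 2) alpha_num) (Times (Plus alpha_num alpha_den) budget_exp))
       (Seq (set_var 6 (var 5)) solve) Skip))"

definition algorithm :: com where
  "algorithm = Seq initialize (Seq double (Seq bisect select))"

text \<open>The invariant \<open>I j\<close> describes the memory before round \<open>j\<close>. It
  must tolerate any change of the loop counter, which the body in turn leaves intact;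
  \<open>30 * h\<close> per round pays for guard and increment.\<close>

lemma runs_for_each:
  assumes body: "\<And>j s. j < n \<Longrightarrow> I j s \<Longrightarrow> s (Work 0) 0 = int j \<Longrightarrow>
      runs n S T P s t (\<lambda>s'. I (Suc j) s' \<and> s' (Work 0) 0 = int j)"
    and size: "\<And>j s. I j s \<Longrightarrow> s InSize 0 = int n"
    and index: "\<And>j s x. I j s \<Longrightarrow> I j (s(Work 0 := (s (Work 0))(0 := x)))"
    and h: "bits (int n) \<le> h" "2 \<le> h"
    and "I 0 s"
    and time: "(n + 2) * (30 * h + t) \<le> u"
  shows "runs n S T (for_each P) s u (I n)"
proof -
  define J where "J i s \<longleftrightarrow> (\<exists>j. i + j = n \<and> s (Work 0) 0 = int j \<and> I j s)" for i s
  let ?g = "Minus size_exp (var 0)"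
  let ?body = "Seq P (set_var 0 (Plus (var 0) (Const 1)))"
  have small: "bits (int j) \<le> h" if "j \<le> n" for j
    using h(1) bits_mono[of "int j" "int n"] that by simp
  have bits01: "bits 0 \<le> h" "bits 1 \<le> h"
    using h(2) bits_le[of 0 0] bits_le[of 1 0] by auto
  have loop: "runs n S T (WhilePos ?g ?body) s'
      ((n + 1) * (h * (2 * operations ?g + 1) + (t + 12 * h))) (\<lambda>s'. (\<exists>i. J i s') \<and> \<not> 0 < eval ?g s')"
    if "J n s'" for s'
  proof (rule runs_WhilePos)
    fix i s assume "J i s"
    then obtain j where j: "i + j = n" "s (Work 0) 0 = int j" "I j s" unfolding J_def by blast
    have diff: "int n - int j = int i" using j(1) by simp
    show "values_within h ?g s"
      using j size[OF j(3)] bits01 small[of j] small[of i] h(1) by (simp add: diff)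
    show "0 < i \<and> runs n S T ?body s (t + 12 * h) (J (i - 1))" if "0 < eval ?g s"
    proof
      show i: "0 < i" using that j size[OF j(3)] by simp
      show "runs n S T ?body s (t + 12 * h) (J (i - 1))"
      proof (rule runs_Seq)
        show "runs n S T P s t (\<lambda>s'. I (Suc j) s' \<and> s' (Work 0) 0 = int j)"
          by (rule body) (use j i in auto)
        fix s' assume s': "I (Suc j) s' \<and> s' (Work 0) 0 = int j"
        show "runs n S T (set_var 0 (Plus (var 0) (Const 1))) s' (12 * h) (J (i - 1))"
        proof (rule runs_Assign)
          have "bits (int j + 1) \<le> h" using small[of "Suc j"] i j(1) by (simp add: add.commute)
          then show "values_within h (Plus (var 0) (Const 1)) s'"
            using bits01 small[of j] s' i j(1) by simp
          show "J (i - 1) (s'(Work 0 := (s' (Work 0))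
              (eval (Const 0) s' := eval (Plus (var 0) (Const 1)) s')))"
            unfolding J_def using index[of "Suc j" s'] s' i j(1) by (intro exI[of _ "Suc j"]) simp
        qed (use bits01 in auto)
      qed simp
    qed
  qed (use that in auto)
  show ?thesis unfolding for_each_def
  proof (rule runs_Seq)
    show "runs n S T (set_var 0 (Const 0)) s (6 * h) (J n)"
      by (rule runs_Assign[of h]) (use bits01 index[OF \<open>I 0 s\<close>] in \<open>auto simp: J_def\<close>)
    show "runs n S T (WhilePos ?g ?body) s' ((n + 1) * (24 * h + t)) (I n)" if "J n s'" for s'
    proof (rule runs_mono[OF loop[OF that]])
      fix s' assume "(\<exists>i. J i s') \<and> \<not> 0 < eval ?g s'"
      then obtain i j where "i + j = n" "s' (Work 0) 0 = int j" "I j s'" "\<not> 0 < eval ?g s'"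
        unfolding J_def by blast
      then show "I n s'" using size[of j s'] by auto
    qed (simp add: algebra_simps)
    have "6 * h + (n + 1) * (24 * h + t) \<le> (n + 2) * (30 * h + t)" by (simp add: algebra_simps)
    then show "6 * h + (n + 1) * (24 * h + t) \<le> u" using time by simp
  qed
qed

section \<open>Magnitudes of the numbers in a run\<close>

locale interdiction_algorithm = interdiction_problem +
  fixes q :: "nat poly" and L :: nat and S :: solver and T :: solver_time and \<alpha> :: rat
  assumes solvable: "box_w_DI_solvable n m A b w q L S T"
    and alpha_pos: "0 < \<alpha>"
begin

abbreviation "total_cost \<equiv> sum c {..<n}"

definition len :: nat where
  "len = input_size n w c B \<alpha> (Sup (objective n w ` described_set n m A b)) L"

definition D :: int where "D = total_cost * B + 1"

definition num :: int where "num = fst (quotient_of \<alpha>)"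
definition den :: int where "den = snd (quotient_of \<alpha>)"

text \<open>\<open>h\<close> bounds the bit lengths of all numbers other than the entries of an answer.\<close>

definition h :: nat where "h = 5 * len + 2"
text \<open>\<open>len + 2 * h * len\<close> bounds \<open>L\<close> plus the size of any query that
  is posed. The second summand thus bounds the time of a solver call, and with it the bit length of
  each answer entry.\<close>

definition H :: nat where "H = h + poly q (len + 2 * h * len)"

text \<open>A common unit of magnitude: input numbers are at most \<open>\<Lambda>\<close>,
  \<open>D\<close> at most \<open>\<Lambda> ^ 2\<close>, multiplier numerators at most
  \<open>\<Lambda> ^ 3\<close> and query numerators at most \<open>\<Lambda> ^ 4\<close>.\<close>

definition \<Lambda> :: int where "\<Lambda> = 2 ^ len"

definition query_list :: "int \<Rightarrow> rat list" where
  "query_list k = map (\<lambda>e. Fract (k * c e) D) [0..<n]"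

definition interdicted :: "int \<Rightarrow> nat set" where
  "interdicted k = {e. e < n \<and> 0 < snd (the (S (query_list k))) ! e}"

lemma interdicted_subset: "interdicted k \<subseteq> {..<n}"
  by (auto simp: interdicted_def)

lemma len_eq:
  "len = bits (int n) + (\<Sum>e<n. bits (w e)) + (\<Sum>e<n. bits (c e)) + bits B + (bits num + bits den) +
     bits \<lceil>\<nu> {}\<rceil> + L"
  by (simp add: len_def input_size_def interdicted_value_empty rat_bits_def num_def den_def)

lemma len_bounds:
  "1 \<le> len" "n \<le> len" "L \<le> len"
proof -
  have "(\<Sum>e<n. 1) \<le> (\<Sum>e<n. bits (w e))" by (intro sum_mono bits_pos)
  then show "n \<le> len" by (simp add: len_eq)
  show "1 \<le> len" "L \<le> len" using bits_pos[of "int n"] by (auto simp: len_eq)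
qed

lemma \<Lambda>_ge_2: "2 \<le> \<Lambda>"
  unfolding \<Lambda>_def using power_increasing[OF len_bounds(1), of "2 :: int"] by simp

lemma less_\<Lambda>:
  assumes "bits k \<le> len"
  shows "\<bar>k\<bar> < \<Lambda>"
proof -
  have "\<bar>k\<bar> < 2 ^ bits k" by (rule abs_less_two_power_bits)
  also have "\<dots> \<le> \<Lambda>" unfolding \<Lambda>_def using assms by (rule power_increasing) simp
  finally show ?thesis .
qed

lemma num_den_pos: "0 < num" "0 < den" and alpha_eq: "real_of_rat \<alpha> = num / den"
proof -
  have quot: "quotient_of \<alpha> = (num, den)" by (simp add: num_def den_def)
  show den: "0 < den" using quotient_of_denom_pos[OF quot] .
  have \<alpha>: "\<alpha> = of_int num / of_int den" using quotient_of_div[OF quot] .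
  have "0 < rat_of_int num / of_int den" using alpha_pos by (subst (asm) \<alpha>)
  then show "0 < num" using den by (simp add: zero_less_divide_iff)
  show "real_of_rat \<alpha> = num / den" by (subst \<alpha>) (simp add: of_rat_divide)
qed

lemma total_cost_nonneg: "0 \<le> total_cost" using cost_nonneg by blast

lemma total_cost_less: "total_cost < \<Lambda>"
proof -
  have "\<bar>total_cost\<bar> < 2 ^ (\<Sum>e<n. bits (c e))" by (rule abs_sum_less_two_power_bits)
  also have "\<dots> \<le> \<Lambda>" unfolding \<Lambda>_def by (intro power_increasing) (auto simp: len_eq)
  finally show ?thesis by simp
qed

lemma input_bounds:
  "int n \<le> \<Lambda>" "total_cost \<le> \<Lambda>" "B \<le> \<Lambda>" "num \<le> \<Lambda>" "den \<le> \<Lambda>" "\<nu> {} + 1 \<le> \<Lambda>"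
proof -
  show "int n \<le> \<Lambda>" using less_\<Lambda>[of "int n"] by (simp add: len_eq)
  show "B \<le> \<Lambda>" using less_\<Lambda>[of "B"] by (simp add: len_eq)
  show "num \<le> \<Lambda>" using less_\<Lambda>[of "num"] by (simp add: len_eq)
  show "den \<le> \<Lambda>" using less_\<Lambda>[of "den"] by (simp add: len_eq)
  show "total_cost \<le> \<Lambda>" using total_cost_less by simp
  have "\<lceil>\<nu> {}\<rceil> + 1 \<le> \<Lambda>" using less_\<Lambda>[of "\<lceil>\<nu> {}\<rceil>"] by (simp add: len_eq)
  then have "real_of_int (\<lceil>\<nu> {}\<rceil> + 1) \<le> real_of_int \<Lambda>" by (simp only: of_int_le_iff)
  then show "\<nu> {} + 1 \<le> \<Lambda>" using le_of_int_ceiling[of "\<nu> {}"] by linarith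
qed

lemma D_bounds: "1 \<le> D" "D \<le> \<Lambda> ^ 2"
proof -
  show "1 \<le> D" using total_cost_nonneg B_pos by (simp add: D_def)
  have "bits B \<le> len" by (simp add: len_eq)
  then have "total_cost * B < \<Lambda> * \<Lambda>"
    using less_\<Lambda>[of B] total_cost_less total_cost_nonneg B_pos by (intro mult_strict_mono') auto
  then show "D \<le> \<Lambda> ^ 2" by (simp add: D_def power2_eq_square)
qed

lemma c_le_total_cost: "e < n \<Longrightarrow> c e \<le> total_cost"
  using cost_le_total[of "{e}"] by simp

lemma power_\<Lambda>_mono: "i \<le> j \<Longrightarrow> x \<le> \<Lambda> ^ i \<Longrightarrow> x \<le> \<Lambda> ^ j"
  using \<Lambda>_ge_2 power_increasing[of i j \<Lambda>] by linarith

lemma bits_le_h: "\<bar>x\<bar> \<le> \<Lambda> ^ i \<Longrightarrow> i \<le> 5 \<Longrightarrow> bits x \<le> h"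
proof -
  assume "\<bar>x\<bar> \<le> \<Lambda> ^ i" "i \<le> 5"
  then have "\<bar>x\<bar> \<le> \<Lambda> ^ 5" using power_\<Lambda>_mono by blast
  then have "\<bar>x\<bar> \<le> 2 ^ (5 * len)" unfolding \<Lambda>_def power_mult[symmetric] by (simp only: mult.commute)
  then show ?thesis unfolding h_def by (rule bits_le)
qed

lemma bits_le_H: "\<bar>x\<bar> \<le> \<Lambda> ^ i \<Longrightarrow> i \<le> 5 \<Longrightarrow> bits x \<le> H"
  using bits_le_h[of x i] by (simp add: H_def)

lemma bits_numeral_le_H: "bits 0 \<le> H" "bits 1 \<le> H" "bits 2 \<le> H"
  by (rule bits_le_H[of _ 1]; use \<Lambda>_ge_2 in simp)+

lemma H_ge_2: "2 \<le> H"
  by (simp add: H_def h_def)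

lemma bits_le_H_input:
  "x \<in> {int n, total_cost, B, num, den, D} \<Longrightarrow> bits x \<le> H"
  "e \<le> n \<Longrightarrow> bits (int e) \<le> H"
  "e < n \<Longrightarrow> bits (c e) \<le> H"
proof -
  show "bits x \<le> H" if "x \<in> {int n, total_cost, B, num, den, D}"
    using that input_bounds(1-5) total_cost_nonneg B_pos num_den_pos D_bounds
      power_\<Lambda>_mono[of 1 2] by (intro bits_le_H[of _ 2]) auto
  show "bits (int e) \<le> H" if "e \<le> n"
    using that input_bounds(1) by (intro bits_le_H[of _ 1]) auto
  show "bits (c e) \<le> H" if "e < n"
    using c_pos[OF that] c_le_total_cost[OF that] input_bounds(2) by (intro bits_le_H[of _ 1]) auto
qed

text \<open>The query for \<open>k\<close> is the Lagrangian relaxation with multiplier \<open>k / D\<close>.\<close>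

lemma solver_answer:
  assumes k: "0 \<le> k" "k \<le> \<Lambda> ^ 3"
  shows "\<exists>v r. S (query_list k) = Some (v, r) \<and> length r = n \<and> (\<forall>e<n. bits (r ! e) \<le> H)"
    and "lagrangian_optimal (k / D) (interdicted k)"
    and "T (query_list k) \<le> H"
    and "e < n \<Longrightarrow> bits (k * c e) \<le> h \<and> bits D \<le> h"
proof -
  have nonneg: "0 \<le> Fract (k * c e) D" if "e < n" for e
    using k c_pos[OF that] D_bounds by (simp add: zero_le_Fract_iff)
  have ok: "length (query_list k) = n" "\<forall>x\<in>set (query_list k). 0 \<le> x"
    using nonneg by (auto simp: query_list_def)
  define u where "u = (\<lambda>e. real_of_rat (query_list k ! e))"
  have u: "u e = k / D * c e" if "e < n" for e
    using that D_bounds(1) by (simp add: u_def query_list_def Fract_of_int_quotient of_rat_divide of_rat_mult)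
  have u0: "\<forall>e<n. 0 \<le> u e"
    using u k c_pos D_bounds(1) by (simp add: less_imp_le)
  have "solver_correct n m A b w S" and polytime: "solver_polytime n q L S T"
    using solvable by (auto simp: box_w_DI_solvable_def)
  then have correct: "case S (query_list k) of
           None \<Rightarrow> boxed_set n m A b u = {}
         | Some (v, r) \<Rightarrow>
             boxed_set n m A b u \<noteq> {} \<and>
             real_of_rat v = Sup (objective n w ` boxed_set n m A b u) \<and>
             length r = n \<and>
             (\<exists>y. (\<forall>i<m. y i \<in> \<int>) \<and>
                  dual_optimal n m A b w u y (\<lambda>e. real_of_int (r ! e)))"
    using ok unfolding solver_correct_def Let_def u_def by blast
  then obtain v r y where r: "S (query_list k) = Some (v, r)" "length r = n"
    "dual_optimal n m A b w u y (\<lambda>e. real_of_int (r ! e))"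
    using boxed_set_nonempty[OF u0] by (auto split: option.splits)
  have "dual_optimal n m A b w (\<lambda>e. k / D * c e) y (\<lambda>e. real_of_int (r ! e))"
  proof -
    have "dual_objective n m b u y' r' = dual_objective n m b (\<lambda>e. k / D * c e) y' r'" for y' r'
      using u by (simp add: dual_objective_def)
    with r(3) show ?thesis by (simp add: dual_optimal_def)
  qed
  then show "lagrangian_optimal (k / D) (interdicted k)"
    using dual_optimal_lagrangian_optimal[of "k / D" y "\<lambda>e. r ! e"] k D_bounds(1) r(1)
    by (simp add: interdicted_def)
  have entry: "bits (k * c e) \<le> h \<and> bits D \<le> h" if "e < n" for e
  proof
    have "k * c e \<le> \<Lambda> ^ 3 * \<Lambda>"
      using k c_pos[OF that] c_le_total_cost[OF that] input_bounds(2) \<Lambda>_ge_2 by (intro mult_mono) auto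
    also have "\<dots> = \<Lambda> ^ 4" by (simp add: power_numeral_reduce)
    finally show "bits (k * c e) \<le> h"
      using k c_pos[OF that] by (intro bits_le_h[of _ 4]) auto
    show "bits D \<le> h" using D_bounds by (intro bits_le_h[of _ 2]) auto
  qed
  then show "e < n \<Longrightarrow> bits (k * c e) \<le> h \<and> bits D \<le> h" .
  have "(\<Sum>x\<leftarrow>query_list k. rat_bits x) = (\<Sum>e<n. rat_bits (Fract (k * c e) D))"
    by (simp add: query_list_def sum_list_distinct_conv_sum_set comp_def lessThan_atLeast0)
  also have "\<dots> \<le> (\<Sum>e<n. 2 * h)"
  proof (rule sum_mono)
    fix e assume "e \<in> {..<n}"
    then have e: "e < n" by simp
    have "rat_bits (Fract (k * c e) D) \<le> bits (k * c e) + bits D"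
      using k c_pos[OF e] D_bounds(1) by (intro rat_bits_Fract_le) auto
    then show "rat_bits (Fract (k * c e) D) \<le> 2 * h" using entry[OF e] by simp
  qed
  also have "\<dots> \<le> 2 * h * len" using len_bounds(2) by (simp add: mult.commute)
  finally have size: "L + (\<Sum>x\<leftarrow>query_list k. rat_bits x) \<le> len + 2 * h * len"
    using len_bounds(3) by simp
  have answer: "answer_size (S (query_list k)) \<le> T (query_list k)"
    and time: "T (query_list k) \<le> poly q (L + (\<Sum>x\<leftarrow>query_list k. rat_bits x))"
    using polytime ok unfolding solver_polytime_def by blast+
  note time
  also have "\<dots> \<le> poly q (len + 2 * h * len)" by (rule poly_mono_nat[OF size])
  finally show T: "T (query_list k) \<le> H" by (simp add: H_def)
  have "bits (r ! e) \<le> H" if "e < n" for e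
  proof -
    have "bits (r ! e) \<le> (\<Sum>k\<leftarrow>r. bits k)"
      using that r(2) by (intro member_le_sum_list) auto
    also have "\<dots> \<le> H" using answer T r(1) by simp
    finally show ?thesis .
  qed
  with r show "\<exists>v r. S (query_list k) = Some (v, r) \<and> length r = n \<and> (\<forall>e<n. bits (r ! e) \<le> H)"
    by blast
qed


section \<open>The solver call as a subroutine\<close>

definition inputs :: "mem \<Rightarrow> bool" where
  "inputs s \<longleftrightarrow> s InSize 0 = int n \<and> (\<forall>e<n. s InCost (int e) = c e) \<and> s InBudget 0 = B \<and>
     s InAlpha 0 = num \<and> s InAlpha 1 = den"

text \<open>Contains only what \<open>solve\<close> preserves; the cost in \<open>Work 2\<close>,
  the loop counter, the output and the query and answer arrays are left open.\<close>

definition state :: "int \<Rightarrow> int \<Rightarrow> int \<Rightarrow> mem \<Rightarrow> bool" where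
  "state k lo hi s \<longleftrightarrow> inputs s \<and> s (Work 6) 0 = k \<and> s (Work 3) 0 = D \<and>
     s (Work 4) 0 = lo \<and> s (Work 5) 0 = hi"

lemmas for_each_rule =
  runs_for_each[where h = H, OF _ _ _ bits_le_H_input(1)[of "int n", simplified] H_ge_2]

lemma runs_write_query:
  assumes "state k lo hi s" and k: "0 \<le> k" "k \<le> \<Lambda> ^ 3"
  shows "runs n S T write_query s ((n + 2) * (60 * H))
    (\<lambda>s'. state k lo hi s' \<and> (\<forall>e<n. s' QueryNum (int e) = k * c e \<and> s' QueryDen (int e) = D))"
proof -
  let ?I = "\<lambda>j s'. state k lo hi s' \<and>
      (\<forall>e<j. s' QueryNum (int e) = k * c e \<and> s' QueryDen (int e) = D)"
  show ?thesis unfolding write_query_def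
  proof (rule for_each_rule[where I = ?I])
    fix j s assume j: "j < n" "?I j s" "s (Work 0) 0 = int j"
    have k_H: "bits k \<le> H" using k by (intro bits_le_H[of _ 3]) auto
    have kc_H: "bits (k * c j) \<le> H"
      using solver_answer(4)[OF k j(1)] by (simp add: H_def)
    note facts = k_H kc_H bits_numeral_le_H bits_le_H_input(1)[of D]
      bits_le_H_input(2)[OF less_imp_le[OF j(1)]] bits_le_H_input(3)[OF j(1)]
      j[unfolded state_def inputs_def]
    show "runs n S T (Seq (Assign QueryNum (var 0) (Times (var 6) cost_exp))
        (Assign QueryDen (var 0) (var 3))) s (30 * H) (\<lambda>s'. ?I (Suc j) s' \<and> s' (Work 0) 0 = int j)"
      by (intro runs_Assign_Seq[where h = H and t = "10 * H"] runs_Assign[where h = H])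
         (simp_all add: facts state_def inputs_def less_Suc_eq)
  next
    show "(n + 2) * (30 * H + 30 * H) \<le> (n + 2) * (60 * H)" by simp
  next
    show "?I 0 s" using assms by simp
  qed (simp_all add: state_def inputs_def)
qed

lemma bits_cost_le_H: "R \<subseteq> {..<n} \<Longrightarrow> bits (sum c R) \<le> H"
  using cost_nonneg[of R] cost_le_total[of R] input_bounds(2) by (intro bits_le_H[of _ 1]) auto

lemma runs_read_answer:
  assumes "state k lo hi s" and R: "R \<subseteq> {..<n}"
    and answer: "\<And>e. e < n \<Longrightarrow> bits (s AnsDual (int e)) \<le> H"
      "\<And>e. e < n \<Longrightarrow> 0 < s AnsDual (int e) \<longleftrightarrow> e \<in> R"
  shows "runs n S T read_answer s (6 * H + (n + 2) * (61 * H))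
    (\<lambda>s'. state k lo hi s' \<and> s' (Work 2) 0 = sum c R \<and> output_set n s' = R)"
proof -
  let ?I = "\<lambda>j s'. state k lo hi s' \<and> s' AnsDual = s AnsDual \<and>
      s' (Work 2) 0 = sum c (R \<inter> {..<j}) \<and> (\<forall>e<j. 0 < s' Out (int e) \<longleftrightarrow> e \<in> R)"
  let ?body = "IfPos (Cell AnsDual (var 0))
       (Seq (Assign Out (var 0) (Const 1)) (set_var 2 (Plus (var 2) cost_exp)))
       (Assign Out (var 0) (Const 0))"
  have loop: "runs n S T (for_each ?body) s' ((n + 2) * (61 * H)) (?I n)" if "?I 0 s'" for s'
  proof (rule for_each_rule[where I = ?I])
    fix j s assume j: "j < n" "?I j s" "s (Work 0) 0 = int j"
    have sum_Suc: "sum c (R \<inter> {..<Suc j}) = sum c (R \<inter> {..<j}) + (if j \<in> R then c j else 0)"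
      by (simp add: lessThan_Suc Int_insert_right)
    have cost: "bits (sum c (R \<inter> {..<j})) \<le> H" "bits (sum c (R \<inter> {..<Suc j})) \<le> H"
      using R by (auto intro!: bits_cost_le_H)
    note facts = bits_numeral_le_H bits_le_H_input(2)[OF less_imp_le[OF j(1)]]
      bits_le_H_input(3)[OF j(1)] answer[OF j(1)] j[unfolded state_def inputs_def]
    show "runs n S T ?body s (31 * H) (\<lambda>s'. ?I (Suc j) s' \<and> s' (Work 0) 0 = int j)"
    proof (rule runs_IfPos[where h = H and t = "24 * H"])
      assume "0 < eval (Cell AnsDual (var 0)) s"
      then have "j \<in> R" using facts by simp
      with sum_Suc cost have sum_j: "sum c (R \<inter> {..<Suc j}) = sum c (R \<inter> {..<j}) + c j"
        "bits (sum c (R \<inter> {..<j})) \<le> H" "bits (sum c (R \<inter> {..<j}) + c j) \<le> H" by simp_all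
      show "runs n S T (Seq (Assign Out (var 0) (Const 1)) (set_var 2 (Plus (var 2) cost_exp))) s
          (24 * H) (\<lambda>s'. ?I (Suc j) s' \<and> s' (Work 0) 0 = int j)"
        by (intro runs_Assign_Seq[where h = H and t = "16 * H"] runs_Assign[where h = H])
           (simp_all add: facts state_def inputs_def less_Suc_eq sum_j \<open>j \<in> R\<close>)
    next
      assume "\<not> 0 < eval (Cell AnsDual (var 0)) s"
      then have "j \<notin> R" using facts by simp
      with sum_Suc have sum_j: "sum c (R \<inter> {..<Suc j}) = sum c (R \<inter> {..<j})" by simp
      show "runs n S T (Assign Out (var 0) (Const 0)) s
          (24 * H) (\<lambda>s'. ?I (Suc j) s' \<and> s' (Work 0) 0 = int j)"
        by (intro runs_Assign[where h = H])
           (simp_all add: facts state_def inputs_def less_Suc_eq sum_j \<open>j \<notin> R\<close>)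
    qed (simp_all add: facts)
  next
    show "(n + 2) * (30 * H + 31 * H) \<le> (n + 2) * (61 * H)" by simp
  qed (use that in \<open>simp_all add: state_def inputs_def\<close>)
  have "R \<inter> {..<n} = R" using R by blast
  then have whole: "sum c (R \<inter> {..<n}) = sum c R" "{e. e < n \<and> e \<in> R} = R" using R by auto
  show ?thesis unfolding read_answer_def
  proof (rule runs_Assign_Seq[where h = H and t = "(n + 2) * (61 * H)"])
    show "runs n S T (for_each ?body) (s(Work 2 := (s (Work 2))(eval (Const 0) s := eval (Const 0) s)))
        ((n + 2) * (61 * H))
        (\<lambda>s'. state k lo hi s' \<and> s' (Work 2) 0 = sum c R \<and> output_set n s' = R)"
    proof (rule runs_mono[OF loop order_refl])
      fix s' assume s': "?I n s'"
      then have "output_set n s' = {e. e < n \<and> e \<in> R}" unfolding output_set_def by blast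
      then show "state k lo hi s' \<and> s' (Work 2) 0 = sum c R \<and> output_set n s' = R"
        using s' whole by simp
    qed (use assms(1) in \<open>simp_all add: state_def inputs_def\<close>)
  qed (simp_all add: bits_numeral_le_H)
qed

definition solve_time :: nat where "solve_time = 200 * (len + 2) * H"

lemma runs_solve:
  assumes "state k lo hi s" and k: "0 \<le> k" "k \<le> \<Lambda> ^ 3"
  shows "runs n S T solve s solve_time
    (\<lambda>s'. state k lo hi s' \<and> s' (Work 2) 0 = sum c (interdicted k) \<and> output_set n s' = interdicted k)"
  unfolding solve_def
proof (rule runs_Seq[OF runs_write_query[OF assms]])
  let ?call_time = "1 + 2 * h * len + H"
  let ?read_time = "6 * H + (n + 2) * (61 * H)"
  let ?Q = "\<lambda>s'. state k lo hi s' \<and> s' (Work 2) 0 = sum c (interdicted k) \<and> output_set n s' = interdicted k"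
  have "1 \<le> H" "h * len \<le> H * len" "n * H \<le> len * H"
    using H_ge_2 len_bounds(2) by (auto simp: H_def)
  moreover have "(n + 2) * (60 * H) = 60 * (n * H) + 120 * H" "(n + 2) * (61 * H) = 61 * (n * H) + 122 * H"
    "solve_time = 200 * (len * H) + 400 * H" "2 * h * len = 2 * (h * len)" "H * len = len * H"
    by (simp_all add: algebra_simps solve_time_def)
  ultimately show "(n + 2) * (60 * H) + (?call_time + ?read_time) \<le> solve_time"
    by linarith
  obtain v r where r: "S (query_list k) = Some (v, r)" "length r = n" "\<And>e. e < n \<Longrightarrow> bits (r ! e) \<le> H"
    using solver_answer(1)[OF k] by blast
  fix s' assume s': "state k lo hi s' \<and> (\<forall>e<n. s' QueryNum (int e) = k * c e \<and> s' QueryDen (int e) = D)"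
  then have query: "query n s' = query_list k" by (simp add: query_def query_list_def)
  have "query_size n s' = (\<Sum>e<n. bits (k * c e) + bits D)"
    using s' by (simp add: query_size_def)
  also have "\<dots> \<le> (\<Sum>e<n. 2 * h)"
    using solver_answer(4)[OF k] by (intro sum_mono) fastforce
  also have "\<dots> \<le> 2 * h * len" using len_bounds(2) by (simp add: mult.commute)
  finally have size: "query_size n s' \<le> 2 * h * len" .
  show "runs n S T (Seq CallSolver read_answer) s' (?call_time + ?read_time) ?Q"
  proof (rule runs_Seq)
    show "runs n S T CallSolver s' ?call_time (\<lambda>s. state k lo hi s \<and> s AnsDual = int_array r)"
      using size solver_answer(3)[OF k] s'
      by (intro runs_CallSolver) (simp_all add: query r state_def inputs_def)
    fix s assume s: "state k lo hi s \<and> s AnsDual = int_array r"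
    show "runs n S T read_answer s ?read_time ?Q"
      by (rule runs_read_answer) (use s r in \<open>auto simp: int_array_def interdicted_def\<close>)
  qed simp
qed

lemma runs_initialize:
  "runs n S T initialize (initial_memory n w c B \<alpha>) ((n + 2) * (46 * H) + 24 * H) (state 1 0 0)"
proof -
  let ?I = "\<lambda>j s. inputs s \<and> s (Work 2) 0 = sum c {..<j} \<and> s (Work 4) 0 = 0 \<and> s (Work 5) 0 = 0"
  show ?thesis unfolding initialize_def
  proof (rule runs_Seq)
    show "runs n S T (for_each (set_var 2 (Plus (var 2) cost_exp))) (initial_memory n w c B \<alpha>)
        ((n + 2) * (46 * H)) (?I n)"
    proof (rule for_each_rule[where I = ?I])
      fix j s assume j: "j < n" "?I j s" "s (Work 0) 0 = int j"
      have cost: "bits (sum c {..<j}) \<le> H" "bits (sum c {..<j} + c j) \<le> H"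
        using j(1) bits_cost_le_H[of "{..<j}"] bits_cost_le_H[of "{..<Suc j}"] by auto
      note facts = bits_numeral_le_H bits_le_H_input(2)[OF less_imp_le[OF j(1)]]
        bits_le_H_input(3)[OF j(1)] j[unfolded inputs_def] cost
      show "runs n S T (set_var 2 (Plus (var 2) cost_exp)) s (16 * H)
          (\<lambda>s'. ?I (Suc j) s' \<and> s' (Work 0) 0 = int j)"
        by (intro runs_Assign[where h = H]) (simp_all add: facts inputs_def)
    next
      show "(n + 2) * (30 * H + 16 * H) \<le> (n + 2) * (46 * H)" by simp
    qed (simp_all add: inputs_def initial_memory_def int_array_def rat_array_def num_def den_def)
    fix s assume s: "?I n s"
    have "bits (total_cost * B) \<le> H"
      using D_bounds total_cost_nonneg B_pos by (intro bits_le_H[of _ 2]) (auto simp: D_def)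
    moreover have "bits (total_cost * B + 1) \<le> H" using bits_le_H_input(1)[of D] by (simp add: D_def)
    ultimately have facts: "bits (total_cost * B) \<le> H" "bits (total_cost * B + 1) \<le> H"
      "bits total_cost \<le> H" "bits B \<le> H"
      using bits_le_H_input(1)[of total_cost] bits_le_H_input(1)[of B] by simp_all
    show "runs n S T (Seq (set_var 3 (Plus (Times (var 2) budget_exp) (Const 1))) (set_var 6 (Const 1))) s
        (24 * H) (state 1 0 0)"
      by (intro runs_Assign_Seq[where h = H and t = "6 * H"] runs_Assign[where h = H])
         (simp_all add: facts bits_numeral_le_H s[unfolded inputs_def] state_def inputs_def D_def)
  qed simp
qed

section \<open>Search for two consecutive multipliers\<close>

definition above_budget :: "int \<Rightarrow> bool" where
  "above_budget k \<longleftrightarrow> B < sum c (interdicted k)"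

text \<open>From \<open>D \<le> \<Lambda> ^ 2\<close> and
  \<open>\<nu> {} + 1 \<le> \<Lambda>\<close> the multiplier \<open>\<Lambda> ^ 3 / D\<close>
  exceeds \<open>\<nu> {}\<close>, where any Lagrangian optimal set has cost zero.\<close>

lemma not_above_budget_large:
  assumes "k = \<Lambda> ^ 3"
  shows "\<not> above_budget k"
proof -
  have "real_of_int D * (\<nu> {} + 1) \<le> real_of_int (\<Lambda> ^ 2) * \<Lambda>"
    using D_bounds input_bounds(6) interdicted_value_nonneg[of "{}"]
    by (intro mult_mono) (simp_all only: of_int_le_iff, auto)
  also have "\<dots> = k" using assms by (simp add: power_numeral_reduce)
  finally have "\<nu> {} + 1 \<le> k / D"
    using D_bounds(1) by (simp add: field_simps)
  then have "\<nu> {} < k / D" by simp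
  moreover have "0 \<le> k" "k \<le> \<Lambda> ^ 3" using assms \<Lambda>_ge_2 by auto
  ultimately have "sum c (interdicted k) = 0"
    using lagrangian_optimal_large solver_answer(2) by blast
  then show ?thesis using B_pos by (simp add: above_budget_def)
qed

lemma bits_budget_difference: "R \<subseteq> {..<n} \<Longrightarrow> bits (sum c R - B) \<le> H"
  using cost_nonneg[of R] cost_le_total[of R] input_bounds B_pos by (intro bits_le_H[of _ 1]) auto

text \<open>After \<open>j\<close> doublings the numerator is \<open>2 ^ j\<close>. At
  \<open>j = 3 * len\<close> it equals \<open>\<Lambda> ^ 3\<close>, which is within budget, so
  \<open>3 * len - j\<close> is a variant.\<close>

lemma runs_double:
  assumes "state 1 0 0 s"
  shows "runs n S T double s ((3 * len + 2) * (25 * H + solve_time))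
    (\<lambda>s'. \<exists>k. state k 0 0 s' \<and> 0 < k \<and> k \<le> \<Lambda> ^ 3 \<and> \<not> above_budget k)"
proof -
  define J where "J i s \<longleftrightarrow> (\<exists>j. i + j = 3 * len \<and> state (2 ^ j) 0 0 s \<and>
    s (Work 2) 0 = sum c (interdicted (2 ^ j)))" for i s
  have \<Lambda>3: "\<Lambda> ^ 3 = 2 ^ (3 * len)" by (simp only: \<Lambda>_def power_mult[symmetric] mult.commute)
  have le: "(2 :: int) ^ j \<le> \<Lambda> ^ 3" if "j \<le> 3 * len" for j
    unfolding \<Lambda>3 using that by (rule power_increasing) simp
  let ?g = "Minus (var 2) budget_exp"
  let ?body = "Seq (set_var 6 (Plus (var 6) (var 6))) solve"
  show ?thesis unfolding double_def
  proof (rule runs_Seq)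
    show "runs n S T solve s solve_time (J (3 * len))"
      by (rule runs_mono[OF runs_solve[OF assms]]) (use le[of 0] in \<open>auto simp: J_def\<close>)
    fix s assume "J (3 * len) s"
    show "runs n S T (WhilePos ?g ?body) s
        ((3 * len + 1) * (25 * H + solve_time))
        (\<lambda>s'. \<exists>k. state k 0 0 s' \<and> 0 < k \<and> k \<le> \<Lambda> ^ 3 \<and> \<not> above_budget k)"
    proof (rule runs_mono[OF runs_WhilePos[where I = J and h = H and t = "14 * H + solve_time"]])
      fix i s assume "J i s"
      then obtain j where j: "i + j = 3 * len" "state (2 ^ j) 0 0 s"
        "s (Work 2) 0 = sum c (interdicted (2 ^ j))" unfolding J_def by blast
      note facts = j(2)[unfolded state_def inputs_def] j(3) bits_numeral_le_H
        bits_le_H_input(1)[of B, simplified]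
        bits_cost_le_H[OF interdicted_subset] bits_budget_difference[OF interdicted_subset]
      show "values_within H ?g s" by (simp add: facts)
      show "0 < i \<and> runs n S T ?body s (14 * H + solve_time) (J (i - 1))" if "0 < eval ?g s"
      proof
        have "above_budget (2 ^ j)" using that by (simp add: facts above_budget_def)
        then have "j \<noteq> 3 * len" using not_above_budget_large \<Lambda>3 by metis
        then show "0 < i" using j(1) by simp
        then have Suc_j: "i - 1 + Suc j = 3 * len" "Suc j \<le> 3 * len" using j(1) by auto
        have "bits (2 ^ j) \<le> H" "bits (2 ^ Suc j) \<le> H"
          using le[of j] le[of "Suc j"] Suc_j by (auto intro!: bits_le_H[of _ 3])
        then have bits_j: "bits (2 ^ j) \<le> H" "bits (2 ^ j + 2 ^ j) \<le> H" "bits (2 * 2 ^ j) \<le> H" by simp_all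
        let ?s = "s(Work 6 := (s (Work 6))(0 := 2 ^ Suc j))"
        have "runs n S T solve ?s solve_time (J (i - 1))"
        proof (rule runs_mono[OF runs_solve])
          show "state (2 ^ Suc j) 0 0 ?s" using facts by (simp add: state_def inputs_def)
        qed (use le[OF Suc_j(2)] Suc_j(1) in \<open>auto simp: J_def intro!: exI[of _ "Suc j"]\<close>)
        then show "runs n S T ?body s (14 * H + solve_time) (J (i - 1))"
          by (intro runs_Assign_Seq[where h = H and t = solve_time])
             (simp_all add: facts bits_j)
      qed
    next
      show "J (3 * len) s" by fact
    next
      fix s' assume "(\<exists>i. J i s') \<and> \<not> 0 < eval ?g s'"
      then obtain i j where j: "i + j = 3 * len" "state (2 ^ j) 0 0 s'"
        "s' (Work 2) 0 = sum c (interdicted (2 ^ j))" "\<not> 0 < eval ?g s'" unfolding J_def by blast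
      then have "\<not> above_budget (2 ^ j)" by (simp add: state_def inputs_def above_budget_def)
      with j le[of j] show "\<exists>k. state k 0 0 s' \<and> 0 < k \<and> k \<le> \<Lambda> ^ 3 \<and> \<not> above_budget k"
        by (intro exI[of _ "2 ^ j"]) simp
    qed (simp add: algebra_simps)
  qed (simp add: algebra_simps)
qed

text \<open>The lower end is over budget or \<open>0\<close>, as
  \<open>lagrangian_optimal_large_cost\<close> requires; the upper end is within budget. The index
  \<open>i\<close> bounds the logarithm of the gap and serves as the variant of the
  bisection.\<close>

definition bracket :: "nat \<Rightarrow> int \<Rightarrow> int \<Rightarrow> bool" where
  "bracket i lo hi \<longleftrightarrow> 0 \<le> lo \<and> lo < hi \<and> hi \<le> \<Lambda> ^ 3 \<and> hi - lo \<le> 2 ^ i \<and>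
     (lo = 0 \<or> above_budget lo) \<and> \<not> above_budget hi"

lemma bracket_halve:
  assumes br: "bracket i lo hi" and gap: "1 < hi - lo"
  defines "mid \<equiv> (lo + hi) div 2"
  shows "0 < i" "0 \<le> mid" "mid \<le> \<Lambda> ^ 3"
    "above_budget mid \<Longrightarrow> bracket (i - 1) mid hi"
    "\<not> above_budget mid \<Longrightarrow> bracket (i - 1) lo mid"
proof -
  show i: "0 < i" using br gap by (cases i) (auto simp: bracket_def)
  have mid: "lo < mid" "mid < hi" "2 * mid \<le> lo + hi" "lo + hi \<le> 2 * mid + 1"
    using gap by (auto simp: mid_def)
  obtain i' where i': "i = Suc i'" using i gr0_implies_Suc by blast
  \<comment> \<open>The upper half may be longer by the rounding, but an integer with
    \<open>2 * x \<le> 2 ^ Suc i' + 1\<close> still satisfies \<open>x \<le> 2 ^ i'\<close>.\<close>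
  have half: "hi - mid \<le> 2 ^ i'" "mid - lo \<le> 2 ^ i'"
    using br mid unfolding bracket_def i' by auto
  show "0 \<le> mid" "mid \<le> \<Lambda> ^ 3" using br mid by (auto simp: bracket_def)
  show "above_budget mid \<Longrightarrow> bracket (i - 1) mid hi" "\<not> above_budget mid \<Longrightarrow> bracket (i - 1) lo mid"
    using br mid half by (auto simp: bracket_def i')
qed

lemma runs_bisect:
  assumes "state k 0 0 s" "0 < k" "k \<le> \<Lambda> ^ 3" "\<not> above_budget k"
  shows "runs n S T bisect s ((3 * len + 2) * (60 * H + solve_time))
    (\<lambda>s'. \<exists>k lo. state k lo (lo + 1) s' \<and> bracket 0 lo (lo + 1))"
proof -
  define J where "J i s \<longleftrightarrow> (\<exists>k lo hi. state k lo hi s \<and> bracket i lo hi)" for i s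
  have "bracket (3 * len) 0 k"
  proof -
    have "\<Lambda> ^ 3 = 2 ^ (3 * len)" by (simp only: \<Lambda>_def power_mult[symmetric] mult.commute)
    with assms show ?thesis by (simp add: bracket_def)
  qed
  let ?g = "Minus (Minus (var 5) (var 4)) (Const 1)"
  let ?if = "IfPos (Minus (var 2) budget_exp) (set_var 4 (var 6)) (set_var 5 (var 6))"
  let ?body = "Seq (set_var 6 (Div (Plus (var 4) (var 5)) (Const 2))) (Seq solve ?if)"
  let ?Q = "\<lambda>s'. \<exists>k lo. state k lo (lo + 1) s' \<and> bracket 0 lo (lo + 1)"
  have loop: "runs n S T (WhilePos ?g ?body) s ((3 * len + 1) * (52 * H + solve_time)) ?Q"
    if "J (3 * len) s" for s
  proof (rule runs_mono[OF runs_WhilePos[where I = J and h = H and t = "37 * H + solve_time"]])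
    fix i s assume "J i s"
    then obtain k lo hi where s: "state k lo hi s" and br: "bracket i lo hi" unfolding J_def by blast
    have lohi: "0 \<le> lo" "lo < hi" "hi \<le> \<Lambda> ^ 3" using br by (auto simp: bracket_def)
    \<comment> \<open>The sum of both ends can exceed \<open>\<Lambda> ^ 3\<close>, but as
      \<open>\<Lambda>\<close> is at least \<open>2\<close> it stays within
      \<open>\<Lambda> ^ 4\<close>.\<close>
    have "\<Lambda> ^ 4 = \<Lambda> * \<Lambda> ^ 3" by (simp add: power_numeral_reduce)
    moreover have "2 * \<Lambda> ^ 3 \<le> \<Lambda> * \<Lambda> ^ 3" using \<Lambda>_ge_2 by (intro mult_right_mono) auto
    ultimately have "bits (lo + hi) \<le> H"
      using lohi by (intro bits_le_H[of _ 4]) auto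
    moreover have "bits lo \<le> H" "bits hi \<le> H" "bits (hi - lo) \<le> H" "bits (hi - lo - 1) \<le> H"
      using lohi by (auto intro!: bits_le_H[of _ 3])
    ultimately have facts: "bits lo \<le> H" "bits hi \<le> H" "bits (hi - lo) \<le> H" "bits (hi - lo - 1) \<le> H"
      "bits (lo + hi) \<le> H" by auto
    note facts = facts bits_numeral_le_H s[unfolded state_def inputs_def]
    show "values_within H ?g s" by (simp add: facts)
    show "0 < i \<and> runs n S T ?body s (37 * H + solve_time) (J (i - 1))" if "0 < eval ?g s"
    proof -
      define mid where "mid = (lo + hi) div 2"
      have "1 < hi - lo" using that by (simp add: facts)
      note mid = bracket_halve[OF br this, folded mid_def]
      have mid_H: "bits mid \<le> H" using mid(2,3) by (intro bits_le_H[of _ 3]) auto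
      let ?s = "s(Work 6 := (s (Work 6))(0 := mid))"
      have "runs n S T (Seq solve ?if) ?s (solve_time + 19 * H) (J (i - 1))"
      proof (rule runs_Seq)
        have "state mid lo hi ?s" using s by (simp add: state_def inputs_def)
        then show "runs n S T solve ?s solve_time (\<lambda>s'. state mid lo hi s' \<and>
            s' (Work 2) 0 = sum c (interdicted mid) \<and> output_set n s' = interdicted mid)"
          using mid(2,3) by (rule runs_solve)
        fix s' assume s': "state mid lo hi s' \<and>
            s' (Work 2) 0 = sum c (interdicted mid) \<and> output_set n s' = interdicted mid"
        note facts' = s'[unfolded state_def inputs_def] mid_H bits_numeral_le_H
          bits_le_H_input(1)[of B, simplified]
          bits_cost_le_H[OF interdicted_subset] bits_budget_difference[OF interdicted_subset]
        show "runs n S T ?if s' (19 * H) (J (i - 1))"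
        proof (rule runs_IfPos[where h = H and t = "8 * H"])
          assume "0 < eval (Minus (var 2) budget_exp) s'"
          then have "above_budget mid" by (simp add: facts' above_budget_def)
          from mid(4)[OF this]
          have "J (i - 1) (s'(Work 4 := (s' (Work 4))(0 := mid)))"
            unfolding J_def using s' by (intro exI[of _ mid] exI[of _ hi]) (simp add: state_def inputs_def)
          then show "runs n S T (set_var 4 (var 6)) s' (8 * H) (J (i - 1))"
            by (intro runs_Assign[where h = H]) (simp_all add: facts')
        next
          assume "\<not> 0 < eval (Minus (var 2) budget_exp) s'"
          then have "\<not> above_budget mid" by (simp add: facts' above_budget_def)
          from mid(5)[OF this]
          have "J (i - 1) (s'(Work 5 := (s' (Work 5))(0 := mid)))"
            unfolding J_def using s'
            by (intro exI[of _ mid] exI[of _ lo] exI[of _ mid]) (simp add: state_def inputs_def)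
          then show "runs n S T (set_var 5 (var 6)) s' (8 * H) (J (i - 1))"
            by (intro runs_Assign[where h = H]) (simp_all add: facts')
        qed (simp_all add: facts')
      qed simp
      then have "runs n S T ?body s (37 * H + solve_time) (J (i - 1))"
        by (intro runs_Assign_Seq[where h = H and t = "solve_time + 19 * H"])
           (simp_all add: facts mid_H flip: mid_def)
      with mid(1) show ?thesis by blast
    qed
  next
    show "J (3 * len) s" by fact
  next
    fix s' assume "(\<exists>i. J i s') \<and> \<not> 0 < eval ?g s'"
    then obtain i k lo hi where s': "state k lo hi s'" "bracket i lo hi" "\<not> 0 < eval ?g s'"
      unfolding J_def by blast
    then have "hi = lo + 1" by (simp add: state_def inputs_def bracket_def)
    with s' show "?Q s'" by (auto simp: bracket_def)
  qed (simp add: algebra_simps)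
  have "bits k \<le> H" using assms by (intro bits_le_H[of _ 3]) auto
  moreover have "J (3 * len) (s(Work 5 := (s (Work 5))(0 := k)))"
    using assms(1) \<open>bracket (3 * len) 0 k\<close> unfolding J_def
    by (intro exI[of _ k] exI[of _ 0] exI[of _ k]) (simp add: state_def inputs_def)
  ultimately show ?thesis unfolding bisect_def
    using assms(1) loop
    by (intro runs_Assign_Seq[where h = H and t = "(3 * len + 1) * (52 * H + solve_time)"])
       (simp_all add: bits_numeral_le_H state_def algebra_simps)
qed

section \<open>Choice between the two sets\<close>

definition result_ok :: "nat set \<Rightarrow> bool" where
  "result_ok R \<longleftrightarrow> approximate_solution n w X c B (1 + real_of_rat \<alpha>) 1 R \<or>
     approximate_solution n w X c B 1 (1 + 1 / real_of_rat \<alpha>) R"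

text \<open>If the test fails, the set of the lower end is cheap enough, and its value is at most
  \<open>OPT\<close> because \<open>lo\<close> is \<open>0\<close> or over budget. If it succeeds,
  \<open>pseudoapproximation\<close> applies to the set of the upper end, which respects the
  budget.\<close>

lemma bracket_result:
  assumes br: "bracket 0 lo (lo + 1)"
  shows "\<not> (num + den) * B < sum c (interdicted lo) * num \<Longrightarrow> result_ok (interdicted lo)"
    and "(num + den) * B < sum c (interdicted lo) * num \<Longrightarrow> result_ok (interdicted (lo + 1))"
proof -
  have lo: "0 \<le> lo" "lo + 1 \<le> \<Lambda> ^ 3" "lo = 0 \<or> above_budget lo" "\<not> above_budget (lo + 1)"
    using br by (auto simp: bracket_def)
  have opt1: "lagrangian_optimal (lo / D) (interdicted lo)"
    using lo by (intro solver_answer(2)) auto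
  have "lagrangian_optimal ((lo + 1) / D) (interdicted (lo + 1))"
    using lo by (intro solver_answer(2)) auto
  then have opt2: "lagrangian_optimal ((real_of_int lo + 1) / D) (interdicted (lo + 1))" by simp
  have \<alpha>: "0 < real_of_rat \<alpha>" using alpha_pos by simp
  let ?c = "sum c (interdicted lo)"
  have "(num + den) * B < ?c * num \<longleftrightarrow> real_of_int ((num + den) * B) < real_of_int (?c * num)"
    by (simp only: of_int_less_iff)
  also have "\<dots> \<longleftrightarrow> (1 + 1 / real_of_rat \<alpha>) * B < ?c"
    \<comment> \<open>With \<open>\<alpha> = num / den\<close> the factor
      \<open>1 + 1 / \<alpha>\<close> is \<open>(num + den) / num\<close>.\<close>
    using num_den_pos unfolding alpha_eq by (simp add: field_simps del: of_int_sum)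
  finally have test: "(num + den) * B < ?c * num \<longleftrightarrow> (1 + 1 / real_of_rat \<alpha>) * B < ?c" .
  show "result_ok (interdicted lo)" if "\<not> (num + den) * B < ?c * num"
  proof -
    have "\<nu> (interdicted lo) \<le> OPT n w X c B"
      using lagrangian_optimal_large_cost[OF opt1] lo D_bounds by (auto simp: above_budget_def)
    then show ?thesis
      using that test interdicted_subset
      by (simp add: result_ok_def approximate_solution_def del: of_int_sum)
  qed
  show "result_ok (interdicted (lo + 1))" if "(num + den) * B < ?c * num"
  proof -
    have "sum c (interdicted (lo + 1)) \<le> B" using lo(4) by (simp add: above_budget_def)
    with pseudoapproximation[OF opt1 opt2 _ D_def this \<alpha>] that test lo(1) interdicted_subset
    show ?thesis by (simp add: result_ok_def approximate_solution_def del: of_int_sum)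
  qed
qed

lemma runs_select:
  assumes "state k lo (lo + 1) s" "bracket 0 lo (lo + 1)"
  shows "runs n S T select s (50 * H + 2 * solve_time) (\<lambda>s'. result_ok (output_set n s'))"
proof -
  have lo: "0 \<le> lo" "lo \<le> \<Lambda> ^ 3" "0 \<le> lo + 1" "lo + 1 \<le> \<Lambda> ^ 3"
    using assms(2) by (auto simp: bracket_def)
  have lo_H: "bits lo \<le> H" "bits (lo + 1) \<le> H"
    using lo by (auto intro!: bits_le_H[of _ 3])
  let ?g = "Minus (Times (var 2) alpha_num) (Times (Plus alpha_num alpha_den) budget_exp)"
  let ?if = "IfPos ?g (Seq (set_var 6 (var 5)) solve) Skip"
  let ?s = "s(Work 6 := (s (Work 6))(0 := lo))"
  have "runs n S T (Seq solve ?if) ?s (solve_time + (37 * H + solve_time)) (\<lambda>s'. result_ok (output_set n s'))"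
  proof (rule runs_Seq)
    have "state lo lo (lo + 1) ?s" using assms(1) by (simp add: state_def inputs_def)
    then show "runs n S T solve ?s solve_time (\<lambda>s'. state lo lo (lo + 1) s' \<and>
        s' (Work 2) 0 = sum c (interdicted lo) \<and> output_set n s' = interdicted lo)"
      using lo(1,2) by (rule runs_solve)
    fix s' assume s': "state lo lo (lo + 1) s' \<and>
        s' (Work 2) 0 = sum c (interdicted lo) \<and> output_set n s' = interdicted lo"
    let ?c = "sum c (interdicted lo)"
    have c: "0 \<le> ?c" "?c \<le> \<Lambda>"
      using cost_nonneg cost_le_total interdicted_subset input_bounds(2) by (blast intro: order_trans)+
    have "0 \<le> ?c * num" "?c * num \<le> \<Lambda> ^ 2"
      using c num_den_pos input_bounds(4) by (auto simp: power2_eq_square intro!: mult_mono)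
    moreover have "0 \<le> (num + den) * B" "(num + den) * B \<le> \<Lambda> ^ 3"
    proof -
      have "(num + den) * B \<le> (\<Lambda> + \<Lambda>) * \<Lambda>"
        using num_den_pos input_bounds(3-5) B_pos by (intro mult_mono add_mono) auto
      also have "\<dots> \<le> \<Lambda> * \<Lambda> * \<Lambda>" using \<Lambda>_ge_2 by (intro mult_right_mono) auto
      finally show "(num + den) * B \<le> \<Lambda> ^ 3" by (simp add: power3_eq_cube)
    qed (use num_den_pos B_pos in auto)
    moreover have "\<Lambda> ^ 2 \<le> \<Lambda> ^ 3" using power_\<Lambda>_mono[of 2 3] by simp
    moreover have "0 \<le> num + den" "num + den \<le> \<Lambda> ^ 2"
    proof -
      have "num + den \<le> 2 * \<Lambda>" using input_bounds by simp
      also have "\<dots> \<le> \<Lambda> * \<Lambda>" using \<Lambda>_ge_2 by (intro mult_right_mono) auto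
      finally show "num + den \<le> \<Lambda> ^ 2" by (simp add: power2_eq_square)
    qed (use num_den_pos in auto)
    \<comment> \<open>Both products lie between \<open>0\<close> and \<open>\<Lambda> ^ 3\<close>,
      hence their difference has absolute value at most \<open>\<Lambda> ^ 3\<close>.\<close>
    ultimately have "bits (?c * num) \<le> H" "bits (num + den) \<le> H" "bits ((num + den) * B) \<le> H"
      "bits (?c * num - (num + den) * B) \<le> H"
      by (auto intro!: bits_le_H[of _ 3])
    note facts = this lo_H s'[unfolded state_def inputs_def] bits_numeral_le_H
      bits_cost_le_H[OF interdicted_subset] bits_le_H_input(1)[of B, simplified]
      bits_le_H_input(1)[of num, simplified] bits_le_H_input(1)[of den, simplified]
    show "runs n S T ?if s' (37 * H + solve_time) (\<lambda>s'. result_ok (output_set n s'))"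
    proof (rule runs_IfPos[where h = H and t = "8 * H + solve_time"])
      assume "0 < eval ?g s'"
      then have "result_ok (interdicted (lo + 1))"
        using bracket_result(2)[OF assms(2)] by (simp add: facts)
      moreover have "state (lo + 1) lo (lo + 1) (s'(Work 6 := (s' (Work 6))(0 := lo + 1)))"
        using s' by (simp add: state_def inputs_def)
      ultimately have "runs n S T solve (s'(Work 6 := (s' (Work 6))(0 := lo + 1))) solve_time
          (\<lambda>s'. result_ok (output_set n s'))"
        using lo(3,4) by (intro runs_mono[OF runs_solve]) auto
      then show "runs n S T (Seq (set_var 6 (var 5)) solve) s' (8 * H + solve_time)
          (\<lambda>s'. result_ok (output_set n s'))"
        by (intro runs_Assign_Seq[where h = H and t = solve_time]) (simp_all add: facts)
    next
      assume "\<not> 0 < eval ?g s'"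
      then have "result_ok (interdicted lo)"
        using bracket_result(1)[OF assms(2)] by (simp add: facts)
      then show "runs n S T Skip s' (8 * H + solve_time) (\<lambda>s'. result_ok (output_set n s'))"
        using s' H_ge_2 by (intro runs_Skip) simp_all
    qed (simp_all add: facts)
  qed simp
  then show ?thesis unfolding select_def using assms(1)
    by (intro runs_Assign_Seq[where h = H and t = "solve_time + (37 * H + solve_time)"])
       (simp_all add: lo_H bits_numeral_le_H state_def)
qed

section \<open>Polynomial bound on the total running time\<close>

definition total_time :: nat where
  "total_time = (len + 2) * (46 * H) + 24 * H + (3 * len + 2) * (25 * H + solve_time) +
     (3 * len + 2) * (60 * H + solve_time) + (50 * H + 2 * solve_time)"

lemma runs_algorithm:
  "runs n S T algorithm (initial_memory n w c B \<alpha>) total_time (\<lambda>s. result_ok (output_set n s))"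
  unfolding algorithm_def
proof (rule runs_Seq[OF runs_initialize])
  let ?Q = "\<lambda>s. result_ok (output_set n s)"
  let ?t2 = "(3 * len + 2) * (60 * H + solve_time)" and ?t3 = "50 * H + 2 * solve_time"
  have "(n + 2) * (46 * H) \<le> (len + 2) * (46 * H)"
    using len_bounds(2) by (intro mult_right_mono) auto
  then show "(n + 2) * (46 * H) + 24 * H + ((3 * len + 2) * (25 * H + solve_time) + (?t2 + ?t3)) \<le> total_time"
    unfolding total_time_def by linarith
  fix s assume "state 1 0 0 s"
  from runs_double[OF this]
  show "runs n S T (Seq double (Seq bisect select)) s
      ((3 * len + 2) * (25 * H + solve_time) + (?t2 + ?t3)) ?Q"
  proof (rule runs_Seq)
    fix s assume "\<exists>k. state k 0 0 s \<and> 0 < k \<and> k \<le> \<Lambda> ^ 3 \<and> \<not> above_budget k"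
    then obtain k where k: "state k 0 0 s" "0 < k" "k \<le> \<Lambda> ^ 3" "\<not> above_budget k" by blast
    from runs_bisect[OF this] show "runs n S T (Seq bisect select) s (?t2 + ?t3) ?Q"
      by (rule runs_Seq) (use runs_select in blast, simp)
  qed simp
qed

end

text \<open>\<open>total_time\<close> as a polynomial in \<open>len\<close>. It is built from
  \<open>q\<close> alone, so that one bound serves all instances and all solvers with time bound
  \<open>q\<close>.\<close>

definition time_bound :: "nat poly \<Rightarrow> nat poly" where
  "time_bound q = (let x = [:0, 1:]; h = 5 * x + 2; H = h + q \<circ>\<^sub>p (x + 2 * h * x); s = 200 * (x + 2) * H in
     (x + 2) * (46 * H) + 24 * H + (3 * x + 2) * (25 * H + s) + (3 * x + 2) * (60 * H + s) +
     (50 * H + 2 * s))"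

lemma poly_numeral_nat: "poly (numeral k) (x :: nat) = numeral k"
  by (metis of_nat_numeral of_nat_id poly_of_nat)

lemma (in interdiction_algorithm) poly_time_bound: "poly (time_bound q) len = total_time"
proof -
  have x: "poly [:0, 1:] len = len" by simp
  show ?thesis
    unfolding time_bound_def Let_def total_time_def solve_time_def H_def h_def
    by (simp only: poly_add poly_mult poly_pcompose poly_numeral_nat x)
qed

theorem theorem4:
  "\<exists>P :: com. \<forall>q :: nat poly. \<exists>p :: nat poly.
     \<forall>(n :: nat) (X :: point set) (w :: nat \<Rightarrow> int) (c :: nat \<Rightarrow> int) (B :: int)
       (m :: nat) (A :: nat \<Rightarrow> nat \<Rightarrow> real) (b :: nat \<Rightarrow> real)
       (S :: solver) (T :: solver_time) (L :: nat) (\<alpha> :: rat).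
       interdiction_instance n X c B \<and>
       (\<forall>e<n. w e \<in> {0, 1}) \<and>
       w_down_closed n w X \<and>
       described_set n m A b = convex hull X \<and>
       box_w_DI_solvable n m A b w q L S T \<and>
       0 < \<alpha> \<longrightarrow>
       (\<exists>t s. exec n S T P (initial_memory n w c B \<alpha>) t s \<and>
          t \<le> poly p (input_size n w c B \<alpha> (Sup (objective n w ` described_set n m A b)) L) \<and>
          (approximate_solution n w X c B (1 + real_of_rat \<alpha>) 1 (output_set n s) \<or>
           approximate_solution n w X c B 1 (1 + 1 / real_of_rat \<alpha>) (output_set n s)))"
proof (rule exI[of _ algorithm], rule allI, rule_tac x = "time_bound q" in exI, intro allI impI)
  fix q n X w c B m A b S T L and \<alpha> :: rat
  assume *: "interdiction_instance n X c B \<and>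
       (\<forall>e<n. w e \<in> {0, 1}) \<and>
       w_down_closed n w X \<and>
       described_set n m A b = convex hull X \<and>
       box_w_DI_solvable n m A b w q L S T \<and>
       0 < \<alpha>"
  then interpret interdiction_algorithm n X w c B m A b q L S T \<alpha>
    by unfold_locales auto
  obtain t s where "exec n S T algorithm (initial_memory n w c B \<alpha>) t s" "t \<le> total_time"
    "result_ok (output_set n s)"
    using runs_algorithm by (auto simp: runs_def)
  then show "\<exists>t s. exec n S T algorithm (initial_memory n w c B \<alpha>) t s \<and>
      t \<le> poly (time_bound q) (input_size n w c B \<alpha> (Sup (objective n w ` described_set n m A b)) L) \<and>
      (approximate_solution n w X c B (1 + real_of_rat \<alpha>) 1 (output_set n s) \<or>
       approximate_solution n w X c B 1 (1 + 1 / real_of_rat \<alpha>) (output_set n s))"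
    using poly_time_bound unfolding len_def result_ok_def by (intro exI[of _ t] exI[of _ s]) simp
qed

end
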